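(* (Explicit solution of the one-dimensional Schr\"odinger equation.) For every $q\in L^1_{\mathrm{loc}}(\mathbb{R})$ and $\lambda\in\mathbb{C}$, the general solution of $$-y''+qy=\lambda y$$ on $\mathbb{R}$ is $$y=y(0)\,C_{q-\lambda,1}+y'(0)\,S_{1,q-\lambda}.$$
   Context: $L^1_{\mathrm{loc}}(\mathbb{R})$ denotes the space of locally integrable complex valued functions on $\mathbb{R}$. A solution of the second order equation is a continuously differentiable function $y:\mathbb{R}\to\mathbb{C}$ such that $y'$ is locally absolutely continuous and the equation holds almost everywhere. "General solution" means that for every choice of $y(0),y'(0)\in\mathbb{C}$ the formula defines a solution with these initial values, and every solution is of this form. In the subscripts, $1$ denotes the constant function $1$ and $q-\lambda$ the function $x\mapsto q(x)-\lambda$. For $u,v\in L^1_{\mathrm{loc}}(\mathbb{R})$ and $j\ge 1$ let $T^{(j)}_{u,v}(s_1,\ldots,s_j)=u(s_1)v(s_2)u(s_3)\cdots$ ($j$ factors, alternating $u$ with $v$, beginning with $u$). Set $A_0(u,v,x)=1$ and, for $j\geq 1$, $$A_j(u,v,x)=\int_{0<s_1<\cdots<s_j<x}T^{(j)}_{u,v}(s_1,\ldots,s_j)\,ds_1\cdots ds_j\quad (x\ge 0),$$ $$A_j(u,v,x)=(-1)^j\int_{x<s_j<\cdots<s_1<0}T^{(j)}_{u,v}(s_1,\ldots,s_j)\,ds_1\cdots ds_j\quad (x\le 0).$$ The bivariate exponential is $E_{u,v}(x)=1+\sum_{j=1}^\infty A_j(u,v,x)$ for $x\in\mathbb{R}$,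 and $$C_{u,v}=\tfrac12\bigl(E_{u,v}+E_{-u,-v}\bigr),\qquad S_{u,v}=\tfrac12\bigl(E_{u,v}-E_{-u,-v}\bigr).$$ *)

theory Defs
  imports "HOL-Analysis.Analysis"
begin

text \<open>
  Elements of \<open>L\<^sup>1\<^sub>l\<^sub>o\<^sub>c(\<real>)\<close> are represented by arbitrary Lebesgue measurable
  (not necessarily Borel measurable) functions.
\<close>

definition locally_integrable :: "(real \<Rightarrow> complex) \<Rightarrow> bool" where
  "locally_integrable f \<longleftrightarrow> (\<forall>K. compact K \<longrightarrow> f absolutely_integrable_on K)"

text \<open>
  Absolute continuity of functions of a real variable, in the usual \<open>\<epsilon>\<close>-\<open>\<delta>\<close> form; the library
  constant \<open>absolutely_continuous\<close> is about measures. The \<open>n\<close> intervals have endpoints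
  \<open>l i \<le> r i\<close>, and their interiors are pairwise disjoint.
\<close>

definition abs_continuous_on :: "real \<Rightarrow> real \<Rightarrow> (real \<Rightarrow> complex) \<Rightarrow> bool" where
  "abs_continuous_on a b f \<longleftrightarrow>
    (\<forall>\<epsilon>>0. \<exists>\<delta>>0. \<forall>(n::nat) (l::nat \<Rightarrow> real) (r::nat \<Rightarrow> real).
       (\<forall>i<n. a \<le> l i \<and> l i \<le> r i \<and> r i \<le> b) \<and>
       disjoint_family_on (\<lambda>i. {l i<..<r i}) {..<n} \<and>
       (\<Sum>i<n. r i - l i) < \<delta>
       \<longrightarrow> (\<Sum>i<n. norm (f (r i) - f (l i))) < \<epsilon>)"

definition locally_abs_continuous :: "(real \<Rightarrow> complex) \<Rightarrow> bool" where
  "locally_abs_continuous f \<longleftrightarrow> (\<forall>a b. a \<le> b \<longrightarrow> abs_continuous_on a b f)"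

definition alt_prod :: "(real \<Rightarrow> complex) \<Rightarrow> (real \<Rightarrow> complex) \<Rightarrow> nat \<Rightarrow> (nat \<Rightarrow> real) \<Rightarrow> complex" where
  "alt_prod u v j s = (\<Prod>i=1..j. if odd i then u (s i) else v (s i))"

text \<open>
  A point \<open>(s\<^sub>1, \<dots>, s\<^sub>j)\<close> of \<open>\<real>\<^sup>j\<close> is a function on the index set \<open>{1..j}\<close>. The factors of the
  product measure are \<open>lebesgue\<close> rather than \<open>lborel\<close>, so that the integrand is measurable
  for all Lebesgue measurable \<open>u\<close> and \<open>v\<close>.
\<close>

definition iter_int :: "nat \<Rightarrow> (real \<Rightarrow> complex) \<Rightarrow> (real \<Rightarrow> complex) \<Rightarrow> real \<Rightarrow> complex" where
  "iter_int j u v x =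
    (if j = 0 then 1
     else if 0 \<le> x then
       (LINT s:{s. 0 < s 1 \<and> (\<forall>i\<in>{1..<j}. s i < s (Suc i)) \<and> s j < x}
          | Pi\<^sub>M {1..j} (\<lambda>_. lebesgue). alt_prod u v j s)
     else
       (- 1) ^ j *
       (LINT s:{s. x < s j \<and> (\<forall>i\<in>{1..<j}. s (Suc i) < s i) \<and> s 1 < 0}
          | Pi\<^sub>M {1..j} (\<lambda>_. lebesgue). alt_prod u v j s))"

definition biv_exp :: "(real \<Rightarrow> complex) \<Rightarrow> (real \<Rightarrow> complex) \<Rightarrow> real \<Rightarrow> complex" where
  "biv_exp u v x = 1 + (\<Sum>j. iter_int (Suc j) u v x)"

definition biv_cosh :: "(real \<Rightarrow> complex) \<Rightarrow> (real \<Rightarrow> complex) \<Rightarrow> real \<Rightarrow> complex" where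
  "biv_cosh u v x = (biv_exp u v x + biv_exp (\<lambda>t. - u t) (\<lambda>t. - v t) x) / 2"

definition biv_sinh :: "(real \<Rightarrow> complex) \<Rightarrow> (real \<Rightarrow> complex) \<Rightarrow> real \<Rightarrow> complex" where
  "biv_sinh u v x = (biv_exp u v x - biv_exp (\<lambda>t. - u t) (\<lambda>t. - v t) x) / 2"

text \<open>
  The equation at a point \<open>x\<close> includes the existence of the second derivative \<open>w\<close> at \<open>x\<close>.
\<close>

definition schroedinger_solution ::
    "(real \<Rightarrow> complex) \<Rightarrow> complex \<Rightarrow> (real \<Rightarrow> complex) \<Rightarrow> bool" where
  "schroedinger_solution q lam y \<longleftrightarrow>
     y C1_differentiable_on UNIV \<and>
     locally_abs_continuous (\<lambda>x. vector_derivative y (at x)) \<and>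
     (AE x in lebesgue. \<exists>w. ((\<lambda>t. vector_derivative y (at t)) has_vector_derivative w) (at x) \<and>
        - w + q x * y x = lam * y x)"

end

theory Submission
  imports Defs
begin

text \<open>
  By Fubini, the iterated integrals \<open>A\<^sub>j\<close> satisfy \<open>A\<^sub>j\<^sub>+\<^sub>1(x) = \<integral>\<^sub>0\<^sup>x w(t) A\<^sub>j(t) dt\<close>, where \<open>w\<close> is
  \<open>u\<close> or \<open>v\<close> according to the parity of \<open>j\<close>, and hence \<open>\<bar>A\<^sub>j\<bar> \<le> \<bar>m\<bar>\<^sup>j / j!\<close> with
  \<open>m(x) = \<integral>\<^sub>0\<^sup>x (\<bar>u\<bar> + \<bar>v\<bar>)\<close>. Summing over even and odd \<open>j\<close> gives \<open>C = 1 + \<integral> v S\<close> and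
  \<open>S = \<integral> u C\<close>, which are the Schroedinger equation in integrated form for \<open>(u, v) = (q - \<lambda>, 1)\<close>
  and \<open>(u, v) = (1, q - \<lambda>)\<close>. Uniqueness follows because the Wronskian of two solutions is
  absolutely continuous with derivative zero almost everywhere, hence constant.
\<close>

section \<open>Absolutely continuous functions\<close>

text \<open>Since \<open>q\<close> is only locally integrable, second derivatives exist merely
  almost everywhere and the calculus of C1 functions does not apply to them. One principle replaces
  it: a locally absolutely continuous function whose derivative vanishes almost everywhere is
  constant. The power formula behind the factorials and the constancy of the Wronskian are both
  instances.

  A second obstacle is circular. The Fubini recursion for \<open>A\<^sub>j\<^sub>+\<^sub>1\<close>
  needs \<open>A\<^sub>j\<close> to be measurable, but \<open>A\<^sub>j(x)\<close> is given as an
  integral over a simplex that moves with \<open>x\<close>. Continuity of \<open>A\<^sub>j\<close>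
  supplies the measurability, and the recursion in turn yields continuity of
  \<open>A\<^sub>j\<^sub>+\<^sub>1\<close>, so a single induction carries both.

  Negative \<open>x\<close> needs no separate theory: the factor \<open>(- 1) ^ j\<close> in
  \<open>iter_int\<close> is the orientation sign of \<open>j\<close> nested integrals starting at
  0, so the recursion reads the same on both half lines.\<close>

lemma abs_continuous_onD:
  assumes "abs_continuous_on a b f" and "\<epsilon> > 0"
  obtains \<delta> where "\<delta> > 0"
    "\<And>(n::nat) l r. (\<And>i. i < n \<Longrightarrow> a \<le> l i \<and> l i \<le> r i \<and> r i \<le> b) \<Longrightarrow>
       disjoint_family_on (\<lambda>i. {l i<..<r i}) {..<n} \<Longrightarrow> (\<Sum>i<n. r i - l i) < \<delta> \<Longrightarrow>
       (\<Sum>i<n. norm (f (r i) - f (l i))) < \<epsilon>"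
proof -
  obtain \<delta> where "\<delta> > 0" and "\<forall>(n::nat) (l::nat \<Rightarrow> real) (r::nat \<Rightarrow> real).
       (\<forall>i<n. a \<le> l i \<and> l i \<le> r i \<and> r i \<le> b) \<and>
       disjoint_family_on (\<lambda>i. {l i<..<r i}) {..<n} \<and>
       (\<Sum>i<n. r i - l i) < \<delta>
       \<longrightarrow> (\<Sum>i<n. norm (f (r i) - f (l i))) < \<epsilon>"
    using assms unfolding abs_continuous_on_def by meson
  then show ?thesis by (intro that[of \<delta>]) auto
qed

lemma abs_continuous_onI:
  assumes "\<And>\<epsilon>. \<epsilon> > 0 \<Longrightarrow> \<exists>\<delta>>0. \<forall>(n::nat) l r. (\<forall>i<n. a \<le> l i \<and> l i \<le> r i \<and> r i \<le> b) \<longrightarrow>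
       disjoint_family_on (\<lambda>i. {l i<..<r i}) {..<n} \<longrightarrow> (\<Sum>i<n. r i - l i) < \<delta> \<longrightarrow>
       (\<Sum>i<n. norm (f (r i) - f (l i))) < \<epsilon>"
  shows "abs_continuous_on a b f"
  unfolding abs_continuous_on_def
proof (intro allI impI)
  fix \<epsilon> :: real assume "\<epsilon> > 0"
  from assms[OF this] show "\<exists>\<delta>>0. \<forall>(n::nat) l r. (\<forall>i<n. a \<le> l i \<and> l i \<le> r i \<and> r i \<le> b) \<and>
       disjoint_family_on (\<lambda>i. {l i<..<r i}) {..<n} \<and> (\<Sum>i<n. r i - l i) < \<delta> \<longrightarrow>
       (\<Sum>i<n. norm (f (r i) - f (l i))) < \<epsilon>"
    by (elim exE conjE) (intro exI conjI; auto)
qed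

lemma abs_continuous_on_imp_continuous_on:
  assumes "abs_continuous_on a b f"
  shows "continuous_on {a..b} f"
proof (unfold continuous_on_iff, intro ballI allI impI)
  fix x e :: real assume x: "x \<in> {a..b}" and e: "0 < e"
  obtain d where d: "d > 0" and D:
    "\<And>(n::nat) l r. (\<And>i. i < n \<Longrightarrow> a \<le> l i \<and> l i \<le> r i \<and> r i \<le> b) \<Longrightarrow>
       disjoint_family_on (\<lambda>i. {l i<..<r i}) {..<n} \<Longrightarrow> (\<Sum>i<n. r i - l i) < d \<Longrightarrow>
       (\<Sum>i<n. norm (f (r i) - f (l i))) < e"
    using abs_continuous_onD[OF assms e] by blast
  have *: "norm (f t - f s) < e" if "a \<le> s" "s \<le> t" "t \<le> b" "t - s < d" for s t
    using D[of 1 "\<lambda>_. s" "\<lambda>_. t"] that by (simp add: disjoint_family_on_def)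
  show "\<exists>d>0. \<forall>x'\<in>{a..b}. dist x' x < d \<longrightarrow> dist (f x') (f x) < e"
  proof (intro exI[of _ d] conjI ballI impI d)
    fix x' assume "x' \<in> {a..b}" "dist x' x < d"
    then show "dist (f x') (f x) < e"
      using *[of x x'] *[of x' x] x by (cases "x \<le> x'") (auto simp: dist_norm norm_minus_commute)
  qed
qed

text \<open>Sums and products both have increments controlled by the increments of \<open>f\<close>
  and \<open>g\<close>, so the argument with finitely many intervals is carried out once, for any
  such \<open>h\<close>.\<close>

lemma abs_continuous_on_linear_bound:
  assumes f: "abs_continuous_on a b f" and g: "abs_continuous_on a b g" and B: "B > 0"
    and h: "\<And>s t. a \<le> s \<Longrightarrow> s \<le> t \<Longrightarrow> t \<le> b \<Longrightarrow>
      norm (h t - h s) \<le> B * (norm (f t - f s) + norm (g t - g s))"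
  shows "abs_continuous_on a b h"
proof (rule abs_continuous_onI)
  fix e :: real assume "e > 0"
  then have e: "e / (2 * B) > 0" using B by simp
  obtain d1 where d1: "d1 > 0" and D1:
    "\<And>(n::nat) l r. (\<And>i. i < n \<Longrightarrow> a \<le> l i \<and> l i \<le> r i \<and> r i \<le> b) \<Longrightarrow>
       disjoint_family_on (\<lambda>i. {l i<..<r i}) {..<n} \<Longrightarrow> (\<Sum>i<n. r i - l i) < d1 \<Longrightarrow>
       (\<Sum>i<n. norm (f (r i) - f (l i))) < e / (2 * B)"
    using abs_continuous_onD[OF f e] by blast
  obtain d2 where d2: "d2 > 0" and D2:
    "\<And>(n::nat) l r. (\<And>i. i < n \<Longrightarrow> a \<le> l i \<and> l i \<le> r i \<and> r i \<le> b) \<Longrightarrow>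
       disjoint_family_on (\<lambda>i. {l i<..<r i}) {..<n} \<Longrightarrow> (\<Sum>i<n. r i - l i) < d2 \<Longrightarrow>
       (\<Sum>i<n. norm (g (r i) - g (l i))) < e / (2 * B)"
    using abs_continuous_onD[OF g e] by blast
  show "\<exists>d>0. \<forall>(n::nat) l r. (\<forall>i<n. a \<le> l i \<and> l i \<le> r i \<and> r i \<le> b) \<longrightarrow>
       disjoint_family_on (\<lambda>i. {l i<..<r i}) {..<n} \<longrightarrow> (\<Sum>i<n. r i - l i) < d \<longrightarrow>
       (\<Sum>i<n. norm (h (r i) - h (l i))) < e"
  proof (intro exI[of _ "min d1 d2"] conjI allI impI)
    show "0 < min d1 d2" using d1 d2 by simp
    fix n :: nat and l r
    assume lr: "\<forall>i<n. a \<le> l i \<and> l i \<le> r i \<and> r i \<le> b"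
      and dj: "disjoint_family_on (\<lambda>i. {l i<..<r i}) {..<n}"
      and s: "(\<Sum>i<n. r i - l i) < min d1 d2"
    have "(\<Sum>i<n. norm (h (r i) - h (l i))) \<le>
        (\<Sum>i<n. B * (norm (f (r i) - f (l i)) + norm (g (r i) - g (l i))))"
      using lr by (intro sum_mono h) auto
    also have "\<dots> = B * ((\<Sum>i<n. norm (f (r i) - f (l i))) + (\<Sum>i<n. norm (g (r i) - g (l i))))"
      by (simp only: sum_distrib_left[symmetric] sum.distrib)
    also have "\<dots> < B * (e / (2 * B) + e / (2 * B))"
      using lr dj s B by (intro mult_strict_left_mono add_strict_mono D1 D2) auto
    also have "\<dots> = e" using B by simp
    finally show "(\<Sum>i<n. norm (h (r i) - h (l i))) < e" .
  qed
qed

lemma abs_continuous_on_mult: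
  assumes f: "abs_continuous_on a b f" and g: "abs_continuous_on a b g"
  shows "abs_continuous_on a b (\<lambda>x. f x * g x)"
proof -
  have "bounded (f ` {a..b})" "bounded (g ` {a..b})"
    using assms by (auto intro!: compact_imp_bounded compact_continuous_image
        abs_continuous_on_imp_continuous_on)
  then obtain F G where F: "F > 0" "\<And>x. x \<in> {a..b} \<Longrightarrow> norm (f x) \<le> F"
    and G: "G > 0" "\<And>x. x \<in> {a..b} \<Longrightarrow> norm (g x) \<le> G"
    unfolding bounded_pos by auto
  show ?thesis
  proof (rule abs_continuous_on_linear_bound[OF f g, of "F + G"])
    fix s t assume st: "a \<le> s" "s \<le> t" "t \<le> b"
    have "f t * g t - f s * g s = (f t - f s) * g t + f s * (g t - g s)"
      by (simp add: algebra_simps)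
    also have "norm \<dots> \<le> norm (f t - f s) * norm (g t) + norm (f s) * norm (g t - g s)"
      by (metis norm_triangle_ineq norm_mult)
    also have "\<dots> \<le> norm (f t - f s) * (F + G) + (F + G) * norm (g t - g s)"
      using st F(2)[of s] G(2)[of t] F(1) G(1)
      by (intro add_mono mult_left_mono mult_right_mono) auto
    finally show "norm (f t * g t - f s * g s) \<le> (F + G) * (norm (f t - f s) + norm (g t - g s))"
      by (simp add: algebra_simps)
  qed (use F G in auto)
qed

lemma locally_abs_continuous_mult:
  "locally_abs_continuous f \<Longrightarrow> locally_abs_continuous g \<Longrightarrow> locally_abs_continuous (\<lambda>x. f x * g x)"
  by (simp add: locally_abs_continuous_def abs_continuous_on_mult)

lemma abs_continuous_on_const: "abs_continuous_on a b (\<lambda>_. c)"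
  by (auto simp: abs_continuous_on_def intro: exI[of _ 1])

lemma locally_abs_continuous_const: "locally_abs_continuous (\<lambda>_. c)"
  by (simp add: locally_abs_continuous_def abs_continuous_on_const)

lemma locally_abs_continuous_add:
  assumes "locally_abs_continuous f" "locally_abs_continuous g"
  shows "locally_abs_continuous (\<lambda>x. f x + g x)"
proof -
  have "norm (f t + g t - (f s + g s)) \<le> 1 * (norm (f t - f s) + norm (g t - g s))" for s t
    using norm_triangle_ineq[of "f t - f s" "g t - g s"] by (simp add: algebra_simps)
  with assms show ?thesis
    unfolding locally_abs_continuous_def by (meson abs_continuous_on_linear_bound zero_less_one)
qed

lemma locally_abs_continuous_diff:
  assumes "locally_abs_continuous f" "locally_abs_continuous g"
  shows "locally_abs_continuous (\<lambda>x. f x - g x)"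
  using locally_abs_continuous_add[OF assms(1)
      locally_abs_continuous_mult[OF locally_abs_continuous_const[of "-1"] assms(2)]]
  by simp

lemma locally_abs_continuous_power:
  "locally_abs_continuous f \<Longrightarrow> locally_abs_continuous (\<lambda>x. f x ^ n)"
  by (induction n) (auto intro: locally_abs_continuous_const locally_abs_continuous_mult)

lemma locally_abs_continuous_imp_continuous:
  assumes "locally_abs_continuous f"
  shows "continuous_on UNIV f"
proof -
  have "isCont f x" for x
  proof -
    have "continuous_on {x - 1..x + 1} f"
      using assms by (intro abs_continuous_on_imp_continuous_on) (simp add: locally_abs_continuous_def)
    then show ?thesis by (rule continuous_on_interior) simp
  qed
  then show ?thesis by (simp add: continuous_at_imp_continuous_on)
qed

section \<open>Constancy from a derivative that vanishes almost everywhere\<close>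

lemma negligible_outer_open:
  assumes "negligible (N :: 'a::euclidean_space set)" and "e > 0"
  obtains U where "open U" "N \<subseteq> U" "U \<in> lmeasurable" "measure lebesgue U < e"
proof -
  have N: "N \<in> sets lebesgue" "N \<in> null_sets lebesgue"
    using assms(1) by (auto simp: negligible_iff_null_sets)
  obtain U where U: "open U" "N \<subseteq> U" "U - N \<in> lmeasurable" "emeasure lebesgue (U - N) < ennreal e"
    using sets_lebesgue_outer_open[OF N(1) assms(2)] by blast
  have "emeasure lebesgue U = emeasure lebesgue (U - N)"
    using N(2) U(1) by (simp add: emeasure_Diff_null_set)
  then have *: "emeasure lebesgue U < ennreal e" using U by simp
  then have "U \<in> lmeasurable"
    using U(1) by (intro fmeasurableI) (auto intro: order_less_trans[OF _ ennreal_less_top])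
  moreover have "measure lebesgue U < e"
    using * calculation assms(2) by (simp add: emeasure_eq_measure2 ennreal_less_iff)
  ultimately show ?thesis using U that by blast
qed

text \<open>
  Take a tagged division that is fine for a gauge adapted to the derivative outside \<open>N\<close> and to a
  small open cover of \<open>N\<close>. Intervals with tag outside \<open>N\<close> contribute little by the derivative,
  those with tag in \<open>N\<close> by absolute continuity.
\<close>

lemma abs_continuous_on_derivative_zero:
  assumes ac: "abs_continuous_on a b f" and ab: "a \<le> b" and N: "negligible N"
    and der: "\<And>x. x \<in> {a..b} - N \<Longrightarrow> (f has_vector_derivative 0) (at x)"
  shows "f b = f a"
proof -
  have "norm (f b - f a) \<le> e * (b - a) + e" if e: "e > 0" for e
  proof -
    obtain \<delta> where d: "\<delta> > 0" and D:
      "\<And>(n::nat) l r. (\<And>i. i < n \<Longrightarrow> a \<le> l i \<and> l i \<le> r i \<and> r i \<le> b) \<Longrightarrow>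
         disjoint_family_on (\<lambda>i. {l i<..<r i}) {..<n} \<Longrightarrow> (\<Sum>i<n. r i - l i) < \<delta> \<Longrightarrow>
         (\<Sum>i<n. norm (f (r i) - f (l i))) < e"
      using abs_continuous_onD[OF ac e] by blast
    obtain U where U: "open U" "N \<subseteq> U" "U \<in> lmeasurable" "measure lebesgue U < \<delta>"
      using negligible_outer_open[OF N d] by blast
    have "\<exists>c>0. \<forall>y. dist y x < c \<longrightarrow> norm (f y - f x) \<le> e * norm (y - x)" if "x \<in> {a..b} - N" for x
      using der[OF that] e unfolding has_vector_derivative_def has_derivative_at_alt
      by (auto simp: dist_norm)
    then obtain c where c: "\<And>x. x \<in> {a..b} - N \<Longrightarrow> c x > 0"
      "\<And>x y. x \<in> {a..b} - N \<Longrightarrow> dist y x < c x \<Longrightarrow> norm (f y - f x) \<le> e * norm (y - x)"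
      by metis
    \<comment> \<open>Tags always lie in \<open>{a..b}\<close>; the value \<open>UNIV\<close>
      elsewhere only makes \<open>\<gamma>\<close> a gauge on the whole line.\<close>
    define \<gamma> where "\<gamma> x = (if x \<in> N then U else if x \<in> {a..b} then ball x (c x) else UNIV)" for x
    have "gauge \<gamma>"
      unfolding gauge_def \<gamma>_def using U c(1) by auto
    then obtain p where p: "p tagged_division_of {a..b}" "\<gamma> fine p"
      using fine_division_exists_real by blast
    note pD = tagged_division_ofD[OF p(1)]
    have K: "\<exists>l r. K = {l..r} \<and> l \<le> x \<and> x \<le> r \<and> a \<le> l \<and> r \<le> b" if "(x, K) \<in> p" for x K
      using pD(2)[OF that] pD(3)[OF that] pD(4)[OF that] by auto
    let ?D = "\<lambda>(x, K). f (Sup K) - f (Inf K)"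
    let ?P = "{z \<in> p. fst z \<in> N}"
    have good: "norm (?D z) \<le> e * (Sup (snd z) - Inf (snd z))" if z: "z \<in> p - ?P" for z
    proof -
      obtain x K' where xK: "z = (x, K')" by (cases z)
      obtain l r where lr: "K' = {l..r}" "l \<le> x" "x \<le> r" "a \<le> l" "r \<le> b"
        using K[of x K'] z xK by auto
      have x: "x \<in> {a..b} - N" using z xK lr by auto
      have "K' \<subseteq> ball x (c x)"
        using p(2) z xK x unfolding fine_def \<gamma>_def by fastforce
      moreover have "l \<in> K'" "r \<in> K'" using lr by auto
      ultimately have "l \<in> ball x (c x)" "r \<in> ball x (c x)" by blast+
      then have "norm (f r - f x) \<le> e * norm (r - x)" "norm (f l - f x) \<le> e * norm (l - x)"
        using c(2)[OF x] by (auto simp: dist_commute)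
      \<comment> \<open>The tag lies between the endpoints, so the errors \<open>e * (r - x)\<close>
        and \<open>e * (x - l)\<close> add up to exactly \<open>e\<close> times the length.\<close>
      then have "norm (f r - f l) \<le> e * (r - l)"
        using norm_triangle_ineq4[of "f r - f x" "f l - f x"] lr by (simp add: algebra_simps)
      then show ?thesis using lr xK by simp
    qed
    have "finite ?P" using pD(1) by simp
    \<comment> \<open>Absolute continuity is phrased for families indexed by naturals, a tagged
      division is a set of pairs; \<open>h\<close> enumerates the pairs with tag in
      \<open>N\<close>.\<close>
    then obtain h where h: "bij_betw h {0..<card ?P} ?P"
      using ex_bij_betw_nat_finite by blast
    define n where "n = card ?P"
    have h: "bij_betw h {..<n} ?P" using h by (simp add: n_def lessThan_atLeast0)
    define l where "l i = Inf (snd (h i))" for i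
    define r where "r i = Sup (snd (h i))" for i
    have hK: "h i \<in> ?P" if "i < n" for i using h that by (auto simp: bij_betw_def)
    have lr: "snd (h i) = {l i..r i} \<and> l i \<le> r i \<and> a \<le> l i \<and> r i \<le> b" if "i < n" for i
    proof -
      have "(fst (h i), snd (h i)) \<in> p" using hK[OF that] by simp
      from K[OF this] obtain l' r' where "snd (h i) = {l'..r'}" "a \<le> l'" "l' \<le> r'" "r' \<le> b"
        by force
      then show ?thesis by (simp add: l_def r_def)
    qed
    have dj: "disjoint_family_on (\<lambda>i. {l i<..<r i}) {..<n}"
      unfolding disjoint_family_on_def
    proof (intro ballI impI)
      fix i j assume ij: "i \<in> {..<n}" "j \<in> {..<n}" "i \<noteq> j"
      then have "h i \<noteq> h j" using h by (auto simp: bij_betw_def inj_on_def)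
      then have "interior (snd (h i)) \<inter> interior (snd (h j)) = {}"
        using pD(5)[of "fst (h i)" "snd (h i)" "fst (h j)" "snd (h j)"] hK ij by auto
      then show "{l i<..<r i} \<inter> {l j<..<r j} = {}"
        using lr ij by simp
    qed
    have sub: "(\<Union>i<n. {l i<..<r i}) \<subseteq> U"
    proof safe
      fix i t assume i: "i < n" and t: "t \<in> {l i<..<r i}"
      have "snd (h i) \<subseteq> \<gamma> (fst (h i))"
        using p(2) hK[OF i] unfolding fine_def by (metis (no_types, lifting) mem_Collect_eq prod.collapse case_prodD)
      then show "t \<in> U" using hK[OF i] lr[OF i] t by (auto simp: \<gamma>_def)
    qed
    \<comment> \<open>Disjoint open intervals inside the cover \<open>U\<close> have total length
      below \<open>\<delta>\<close>, whatever their number.\<close>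
    have "(\<Sum>i<n. r i - l i) = (\<Sum>i<n. measure lebesgue {l i<..<r i})"
      using lr by (intro sum.cong) auto
    also have "\<dots> = measure lebesgue (\<Union>i<n. {l i<..<r i})"
      using dj lr by (intro measure_finite_Union[symmetric]) auto
    also have "\<dots> \<le> measure lebesgue U"
      using U(3) by (intro measure_mono_fmeasurable sub) auto
    finally have "(\<Sum>i<n. r i - l i) < \<delta>" using U(4) by simp
    then have "(\<Sum>i<n. norm (f (r i) - f (l i))) < e"
      using lr by (intro D dj) auto
    also have "(\<Sum>i<n. norm (f (r i) - f (l i))) = (\<Sum>z\<in>?P. norm (?D z))"
      by (subst sum.reindex_bij_betw[OF h, symmetric]) (simp add: l_def r_def case_prod_beta)
    finally have bad: "(\<Sum>z\<in>?P. norm (?D z)) < e" .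
    have "(\<Sum>z\<in>p - ?P. norm (?D z)) \<le> (\<Sum>z\<in>p - ?P. e * (Sup (snd z) - Inf (snd z)))"
      by (intro sum_mono good)
    also have "\<dots> \<le> (\<Sum>z\<in>p. e * (Sup (snd z) - Inf (snd z)))"
    proof (intro sum_mono2)
      fix z assume "z \<in> p - (p - ?P)"
      then show "0 \<le> e * (Sup (snd z) - Inf (snd z))"
        using K[of "fst z" "snd z"] e by auto
    qed (use pD(1) in auto)
    also have "\<dots> = e * (b - a)"
      using additive_tagged_division_1[OF ab p(1), of "\<lambda>x. x"]
      by (simp add: sum_distrib_left[symmetric] case_prod_beta)
    finally have g: "(\<Sum>z\<in>p - ?P. norm (?D z)) \<le> e * (b - a)" .
    have "f b - f a = sum ?D p" using additive_tagged_division_1[OF ab p(1), of f] by simp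
    also have "norm \<dots> \<le> (\<Sum>z\<in>p. norm (?D z))" by (rule norm_sum)
    also have "\<dots> = (\<Sum>z\<in>p - ?P. norm (?D z)) + (\<Sum>z\<in>?P. norm (?D z))"
      using pD(1) by (intro sum.subset_diff) auto
    finally show ?thesis using bad g by simp
  qed
  note * = this
  have "norm (f b - f a) \<le> 0"
  proof (rule field_le_epsilon)
    fix e :: real assume "e > 0"
    \<comment> \<open>The bound \<open>e * (b - a) + e\<close> is \<open>e * (b - a + 1)\<close>,
      hence the division by \<open>b - a + 1\<close>; the summand 1 keeps the divisor positive when
      \<open>a = b\<close>.\<close>
    then have "norm (f b - f a) \<le> e / (b - a + 1) * (b - a) + e / (b - a + 1)"
      using ab by (intro *) simp
    also have "\<dots> = e / (b - a + 1) * (b - a + 1)" by (simp only: distrib_left mult_1_right)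
    also have "\<dots> = e" using ab by simp
    finally show "norm (f b - f a) \<le> 0 + e" by simp
  qed
  then show ?thesis by simp
qed

lemma locally_abs_continuous_derivative_zero:
  assumes "locally_abs_continuous f" "AE x in lebesgue. (f has_vector_derivative 0) (at x)"
  shows "f x = f y"
proof -
  obtain N where N: "negligible N" "{x. \<not> (f has_vector_derivative 0) (at x)} \<subseteq> N"
    using assms(2) unfolding eventually_ae_filter_negligible by (elim exE conjE)
  have "f b = f a" if "a \<le> b" for a b
  proof (rule abs_continuous_on_derivative_zero[OF _ that N(1)])
    show "abs_continuous_on a b f" using assms(1) that by (simp add: locally_abs_continuous_def)
  qed (use N(2) in blast)
  then show ?thesis using linear[of x y] by metis
qed

section \<open>Primitives of locally integrable functions\<close>

lemma locally_integrable_iff: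
  "locally_integrable g \<longleftrightarrow> (\<forall>a b. g absolutely_integrable_on {a..b})"
proof
  assume g: "\<forall>a b. g absolutely_integrable_on {a..b}"
  show "locally_integrable g"
    unfolding locally_integrable_def
  proof (intro allI impI)
    fix K :: "real set" assume K: "compact K"
    then obtain a b where "K \<subseteq> {a..b}"
      using bounded_subset_cbox_symmetric[OF compact_imp_bounded[OF K]] by (metis box_real(2))
    moreover have "K \<in> sets lebesgue"
      using K by (simp add: borel_compact)
    ultimately show "g absolutely_integrable_on K"
      using g set_integrable_subset by blast
  qed
qed (simp add: locally_integrable_def)

lemma locally_integrableD:
  assumes "locally_integrable g"
  shows "g absolutely_integrable_on {a..b}" "g integrable_on {a..b}"
    "(\<lambda>x. norm (g x)) integrable_on {a..b}"
  using assms by (auto simp: locally_integrable_iff absolutely_integrable_on_def)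

text \<open>Local integrability is not preserved by products in general; a continuous factor is
  harmless because it is bounded on compact intervals.\<close>

lemma locally_integrable_mult_continuous:
  assumes g: "locally_integrable g" and f: "continuous_on UNIV f"
  shows "locally_integrable (\<lambda>x. g x * f x)"
  unfolding locally_integrable_iff
proof (intro allI)
  fix a b :: real
  have f': "continuous_on {a..b} f" using f continuous_on_subset by blast
  have "(\<lambda>x. f x * g x) absolutely_integrable_on {a..b}"
  proof (rule absolutely_integrable_bounded_measurable_product[OF bilinear_times])
    show "f \<in> borel_measurable (lebesgue_on {a..b})"
      using f' by (intro continuous_imp_measurable_on_sets_lebesgue) auto
    show "bounded (f ` {a..b})"
      using f' by (intro compact_imp_bounded compact_continuous_image) auto
  qed (use g in \<open>auto simp: locally_integrableD\<close>)
  then show "(\<lambda>x. g x * f x) absolutely_integrable_on {a..b}" by (simp add: mult.commute)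
qed

lemma continuous_imp_locally_integrable: "continuous_on UNIV f \<Longrightarrow> locally_integrable f"
  unfolding locally_integrable_iff
  by (intro allI absolutely_integrable_continuous_real) (rule continuous_on_subset, auto)

text \<open>The oriented integral from 0 to \<open>x\<close>, hence additive across 0.\<close>

definition primitive :: "(real \<Rightarrow> complex) \<Rightarrow> real \<Rightarrow> complex" where
  "primitive g x = (if 0 \<le> x then integral {0..x} g else - integral {x..0} g)"

lemma primitive_0 [simp]: "primitive g 0 = 0"
  by (simp add: primitive_def)

lemma primitive_diff:
  assumes "locally_integrable g" "a \<le> b"
  shows "primitive g b - primitive g a = integral {a..b} g"
proof -
  note i = locally_integrableD(2)[OF assms(1)]
  consider "0 \<le> a" | "a < 0" "0 \<le> b" | "b < 0" by linarith
  then show ?thesis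
  proof cases
    case 1 then show ?thesis
      using Henstock_Kurzweil_Integration.integral_combine[of 0 a b g] i assms(2)
      by (simp add: primitive_def algebra_simps)
  next
    case 2 then show ?thesis
      using Henstock_Kurzweil_Integration.integral_combine[of a 0 b g] i assms(2)
      by (simp add: primitive_def algebra_simps)
  next
    case 3 then show ?thesis
      using Henstock_Kurzweil_Integration.integral_combine[of a b 0 g] i assms(2)
      by (simp add: primitive_def algebra_simps)
  qed
qed

section \<open>Absolute continuity of primitives\<close>

lemma sum_integral_disjoint_le:
  fixes h :: "real \<Rightarrow> real"
  assumes h: "\<And>a b. h integrable_on {a..b}" "\<And>x. 0 \<le> h x"
    and lr: "\<And>i. i < (n::nat) \<Longrightarrow> a \<le> l i \<and> l i \<le> r i \<and> r i \<le> b"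
    and dj: "disjoint_family_on (\<lambda>i. {l i<..<r i}) {..<n}"
  shows "(\<Sum>i<n. integral {l i..r i} h) \<le> integral {a..b} h"
proof -
  \<comment> \<open>The closed intervals may share endpoints; passing to the open ones makes them
    disjoint and leaves each integral unchanged.\<close>
  have "(h has_integral (\<Sum>i<n. integral {l i..r i} h)) (\<Union>i\<in>{..<n}. {l i<..<r i})"
  proof (rule has_integral_UN)
    show "(h has_integral integral {l i..r i} h) {l i<..<r i}" for i
      using h(1) by (metis has_integral_Icc_iff_Ioo integrable_integral)
    show "pairwise (\<lambda>i i'. negligible ({l i<..<r i} \<inter> {l i'<..<r i'})) {..<n}"
      using dj unfolding pairwise_def disjoint_family_on_def by simp
  qed simp
  then show ?thesis
  proof (rule has_integral_subset_le[rotated 1])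
    show "(\<Union>i\<in>{..<n}. {l i<..<r i}) \<subseteq> {a..b}" using lr by force
  qed (use h in auto)
qed

text \<open>At each point the truncation is exact as soon as \<open>k\<close> exceeds the norm, and
  the error never exceeds \<open>norm (g x)\<close>, so dominated convergence applies.\<close>

lemma truncation_error_tendsto_0:
  fixes g :: "real \<Rightarrow> 'a::euclidean_space"
  assumes "g absolutely_integrable_on {a..b}"
  shows "(\<lambda>k. integral {a..b} (\<lambda>x. norm (g x) - min (norm (g x)) (real k))) \<longlonglongrightarrow> 0"
proof -
  have n: "(\<lambda>x. norm (g x)) absolutely_integrable_on {a..b}"
    using assms by (simp add: absolutely_integrable_on_def)
  have i: "(\<lambda>x. min (norm (g x)) (real k)) integrable_on {a..b}" for k
    using absolutely_integrable_min_1[OF n, of "\<lambda>_. real k"]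
    by (auto simp: absolutely_integrable_on_def)
  have "(\<lambda>k. integral {a..b} (\<lambda>x. norm (g x) - min (norm (g x)) (real k)))
      \<longlonglongrightarrow> integral {a..b} (\<lambda>_. 0)"
  proof (rule dominated_convergence(2)[where h = "\<lambda>x. norm (g x)"])
    show "(\<lambda>x. norm (g x)) integrable_on {a..b}" using n by (simp add: absolutely_integrable_on_def)
    then show "(\<lambda>x. norm (g x) - min (norm (g x)) (real k)) integrable_on {a..b}" for k
      using i by (intro integrable_diff) auto
    show "(\<lambda>k. norm (g x) - min (norm (g x)) (real k)) \<longlonglongrightarrow> 0" for x
    proof (rule tendsto_eventually)
      show "\<forall>\<^sub>F k in sequentially. norm (g x) - min (norm (g x)) (real k) = 0"
        using eventually_ge_at_top[of "nat \<lceil>norm (g x)\<rceil>"]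
        by eventually_elim (simp add: nat_le_iff ceiling_le_iff)
    qed
  qed auto
  then show ?thesis by simp
qed

text \<open>Split \<open>norm (g x)\<close> into its truncation at height \<open>k\<close> and the
  excess. For large \<open>k\<close> the excess has integral below \<open>e / 2\<close> over all of
  \<open>{a..b}\<close>, hence over any disjoint subintervals; the truncated part contributes at
  most a constant times the total length.\<close>

lemma locally_abs_continuous_primitive:
  assumes g: "locally_integrable g"
  shows "locally_abs_continuous (primitive g)"
  unfolding locally_abs_continuous_def
proof (intro allI impI)
  fix a b :: real assume "a \<le> b"
  note n = locally_integrableD(3)[OF g]
  show "abs_continuous_on a b (primitive g)"
  proof (rule abs_continuous_onI)
    fix e :: real assume e: "e > 0"
    then have "\<forall>\<^sub>F k in sequentially.
        integral {a..b} (\<lambda>x. norm (g x) - min (norm (g x)) (real k)) < e / 2"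
      using truncation_error_tendsto_0[OF locally_integrableD(1)[OF g]]
      by (intro order_tendstoD(2)) auto
    then obtain k where k: "integral {a..b} (\<lambda>x. norm (g x) - min (norm (g x)) (real k)) < e / 2"
      by (auto simp: eventually_sequentially)
    let ?h = "\<lambda>x. norm (g x) - min (norm (g x)) (real k)"
    have hi: "?h integrable_on {c..d}" for c d
    proof (rule integrable_diff[OF n])
      have "(\<lambda>x. norm (g x)) absolutely_integrable_on {c..d}"
        using n by (simp add: absolutely_integrable_on_def)
      from absolutely_integrable_min_1[OF this, of "\<lambda>_. real k"]
      show "(\<lambda>x. min (norm (g x)) (real k)) integrable_on {c..d}"
        by (auto simp: absolutely_integrable_on_def)
    qed
    have *: "norm (primitive g d - primitive g c) \<le> integral {c..d} ?h + (real k + 1) * (d - c)"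
      if "c \<le> d" for c d
    proof -
      have "norm (integral {c..d} g) \<le> integral {c..d} (\<lambda>x. ?h x + (real k + 1))"
        using locally_integrableD(2)[OF g] hi
        by (intro Henstock_Kurzweil_Integration.integral_norm_bound_integral integrable_add) auto
      also have "\<dots> = integral {c..d} ?h + (real k + 1) * (d - c)"
        using that by (subst Henstock_Kurzweil_Integration.integral_add[OF hi])
          (auto simp: mult.commute)
      finally show ?thesis using primitive_diff[OF g that] by simp
    qed
    show "\<exists>\<delta>>0. \<forall>(n::nat) l r. (\<forall>i<n. a \<le> l i \<and> l i \<le> r i \<and> r i \<le> b) \<longrightarrow>
       disjoint_family_on (\<lambda>i. {l i<..<r i}) {..<n} \<longrightarrow> (\<Sum>i<n. r i - l i) < \<delta> \<longrightarrow>
       (\<Sum>i<n. norm (primitive g (r i) - primitive g (l i))) < e"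
    \<comment> \<open>With this length the bounded part contributes the other \<open>e / 2\<close>;
      the height \<open>k + 1\<close> in place of \<open>k\<close> avoids dividing by zero for
      \<open>k = 0\<close>.\<close>
    proof (intro exI[of _ "e / (2 * (real k + 1))"] conjI allI impI)
      show "0 < e / (2 * (real k + 1))" using e by simp
      fix n :: nat and l r
      assume lr: "\<forall>i<n. a \<le> l i \<and> l i \<le> r i \<and> r i \<le> b"
        and dj: "disjoint_family_on (\<lambda>i. {l i<..<r i}) {..<n}"
        and s: "(\<Sum>i<n. r i - l i) < e / (2 * (real k + 1))"
      have "(\<Sum>i<n. norm (primitive g (r i) - primitive g (l i)))
          \<le> (\<Sum>i<n. integral {l i..r i} ?h + (real k + 1) * (r i - l i))"
        using lr by (intro sum_mono *) auto
      also have "\<dots> = (\<Sum>i<n. integral {l i..r i} ?h) + (real k + 1) * (\<Sum>i<n. r i - l i)"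
        by (simp only: sum.distrib sum_distrib_left)
      also have "\<dots> < e / 2 + (real k + 1) * (e / (2 * (real k + 1)))"
      proof (rule add_strict_mono)
        have "(\<Sum>i<n. integral {l i..r i} ?h) \<le> integral {a..b} ?h"
          using lr by (intro sum_integral_disjoint_le hi dj) auto
        with k show "(\<Sum>i<n. integral {l i..r i} ?h) < e / 2" by simp
      qed (use s in \<open>intro mult_strict_left_mono, auto\<close>)
      also have "(real k + 1) * (e / (2 * (real k + 1))) = e / 2"
        by (simp add: field_simps add_eq_0_iff)
      finally show "(\<Sum>i<n. norm (primitive g (r i) - primitive g (l i))) < e" by simp
    qed
  qed
qed

lemma continuous_on_primitive: "locally_integrable g \<Longrightarrow> continuous_on S (primitive g)"
  using locally_abs_continuous_imp_continuous[OF locally_abs_continuous_primitive]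
  by (rule continuous_on_subset) auto

section \<open>Differentiation of primitives and the fundamental theorem of calculus\<close>

lemma primitive_has_vector_derivativeI:
  assumes g: "locally_integrable g"
    and r: "\<And>e. e > 0 \<Longrightarrow> \<exists>d>0. \<forall>h. 0 < h \<and> h < d \<longrightarrow> norm (integral {x..x + h} g /\<^sub>R h - g x) < e"
    and l: "\<And>e. e > 0 \<Longrightarrow> \<exists>d>0. \<forall>h. 0 < h \<and> h < d \<longrightarrow> norm (integral {x - h..x} g /\<^sub>R h - g x) < e"
  shows "(primitive g has_vector_derivative g x) (at x)"
  unfolding has_vector_derivative_def has_derivative_at_alt
proof (intro conjI allI impI)
  show "bounded_linear (\<lambda>h. h *\<^sub>R g x)" by (rule bounded_linear_scaleR_left)
  fix e :: real assume "e > 0"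
  obtain d1 where d1: "d1 > 0"
    "\<And>h. 0 < h \<and> h < d1 \<Longrightarrow> norm (integral {x..x + h} g /\<^sub>R h - g x) < e"
    using r[OF \<open>e > 0\<close>] by blast
  obtain d2 where d2: "d2 > 0"
    "\<And>h. 0 < h \<and> h < d2 \<Longrightarrow> norm (integral {x - h..x} g /\<^sub>R h - g x) < e"
    using l[OF \<open>e > 0\<close>] by blast
  have *: "norm (I - h *\<^sub>R g x) \<le> e * h" if "norm (I /\<^sub>R h - g x) < e" "h > 0" for I h
  proof -
    have "I - h *\<^sub>R g x = h *\<^sub>R (I /\<^sub>R h - g x)" using that by (simp add: scaleR_right_diff_distrib)
    then have "norm (I - h *\<^sub>R g x) = h * norm (I /\<^sub>R h - g x)" using that by simp
    also have "\<dots> \<le> h * e" using that by (intro mult_left_mono) auto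
    finally show ?thesis by (simp add: mult.commute)
  qed
  show "\<exists>d>0. \<forall>y. norm (y - x) < d \<longrightarrow>
      norm (primitive g y - primitive g x - (y - x) *\<^sub>R g x) \<le> e * norm (y - x)"
  proof (intro exI[of _ "min d1 d2"] conjI allI impI)
    show "0 < min d1 d2" using d1 d2 by simp
    fix y :: real assume y: "norm (y - x) < min d1 d2"
    consider "y = x" | "y > x" | "y < x" by linarith
    then show "norm (primitive g y - primitive g x - (y - x) *\<^sub>R g x) \<le> e * norm (y - x)"
    proof cases
      case 2
      with y d1(2)[of "y - x"] have "norm (integral {x..y} g /\<^sub>R (y - x) - g x) < e" by simp
      from *[OF this] 2 show ?thesis by (simp add: primitive_diff[OF g])
    next
      case 3
      with y d2(2)[of "x - y"] have "norm (integral {y..x} g /\<^sub>R (x - y) - g x) < e" by simp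
      from *[OF this] 3 have "norm (integral {y..x} g - (x - y) *\<^sub>R g x) \<le> e * (x - y)" by simp
      moreover have "primitive g y - primitive g x - (y - x) *\<^sub>R g x
          = - (integral {y..x} g - (x - y) *\<^sub>R g x)"
        using primitive_diff[OF g, of y x] 3 by (simp add: algebra_simps)
      ultimately have "norm (primitive g y - primitive g x - (y - x) *\<^sub>R g x) \<le> e * (x - y)"
        by (simp only: norm_minus_cancel)
      then show ?thesis using 3 by simp
    qed simp
  qed
qed

text \<open>The Lebesgue differentiation theorem. \<open>integrable_ccontinuous_explicit\<close>
  treats averages over \<open>{x..x + h}\<close>; averages to the left of \<open>x\<close> become
  averages to the right of \<open>- x\<close> for the reflected function. The exceptional set is
  therefore \<open>N1\<close> together with the mirror image of \<open>N2\<close>.\<close>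

lemma AE_primitive_has_vector_derivative:
  assumes g: "locally_integrable g"
  shows "AE x in lebesgue. (primitive g has_vector_derivative g x) (at x)"
proof -
  obtain N1 where N1: "negligible N1" "\<And>x e. x \<notin> N1 \<Longrightarrow> e > 0 \<Longrightarrow>
      \<exists>d>0. \<forall>h. 0 < h \<and> h < d \<longrightarrow> norm (integral {x..x + h} g /\<^sub>R h - g x) < e"
    using integrable_ccontinuous_explicit[where f = g] locally_integrableD(2)[OF g] by auto
  have "(\<lambda>t. g (- t)) integrable_on {a..b}" for a b
    using Henstock_Kurzweil_Integration.integrable_reflect_real[where f = g and a = "-b" and b = "-a"] locally_integrableD(2)[OF g] by simp
  then obtain N2 where N2: "negligible N2" "\<And>x e. x \<notin> N2 \<Longrightarrow> e > 0 \<Longrightarrow>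
      \<exists>d>0. \<forall>h. 0 < h \<and> h < d \<longrightarrow> norm (integral {x..x + h} (\<lambda>t. g (- t)) /\<^sub>R h - g (- x)) < e"
    using integrable_ccontinuous_explicit[where f = "\<lambda>t. g (- t)"] by auto
  have N: "negligible (N1 \<union> uminus ` N2)"
    using N1(1) N2(1)
    by (intro negligible_Un negligible_differentiable_image_negligible)
      (auto intro!: derivative_intros)
  have "(primitive g has_vector_derivative g x) (at x)" if x: "x \<notin> N1 \<union> uminus ` N2" for x
  proof (rule primitive_has_vector_derivativeI[OF g])
    fix e :: real assume e: "e > 0"
    show "\<exists>d>0. \<forall>h. 0 < h \<and> h < d \<longrightarrow> norm (integral {x..x + h} g /\<^sub>R h - g x) < e"
      using N1(2)[OF _ e] x by blast
    have "- x \<notin> N2" using x by (metis UnCI add.inverse_inverse imageI)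
    from N2(2)[OF this e] obtain d where d: "d > 0"
      "\<And>h. 0 < h \<and> h < d \<Longrightarrow> norm (integral {- x..- x + h} (\<lambda>t. g (- t)) /\<^sub>R h - g x) < e"
      by auto
    have "integral {- x..- x + h} (\<lambda>t. g (- t)) = integral {x - h..x} g" for h
      using Henstock_Kurzweil_Integration.integral_reflect_real[of x "x - h" g] by simp
    with d show "\<exists>d>0. \<forall>h. 0 < h \<and> h < d \<longrightarrow> norm (integral {x - h..x} g /\<^sub>R h - g x) < e"
      by auto
  qed
  then show ?thesis
    unfolding eventually_ae_filter_negligible using N by (intro exI[of _ "N1 \<union> uminus ` N2"]) auto
qed

text \<open>A solution must be differentiable at every point, so the almost everywhere statement
  does not suffice for the first derivative. The base point is moved from 0 to \<open>x - 1\<close>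
  so that \<open>x\<close> is interior to the interval of integration.\<close>

lemma primitive_continuous_has_vector_derivative:
  assumes g: "continuous_on UNIV g"
  shows "(primitive g has_vector_derivative g x) (at x)"
proof -
  let ?a = "x - 1" let ?b = "x + 1"
  have "((\<lambda>u. integral {?a..u} g) has_vector_derivative g x) (at x within {?a..?b})"
    using g by (intro integral_has_vector_derivative) (auto intro: continuous_on_subset)
  then have "((\<lambda>u. primitive g ?a + integral {?a..u} g) has_vector_derivative g x) (at x)"
    by (auto intro!: derivative_eq_intros simp: at_within_Icc_at)
  then show ?thesis
  proof (rule has_vector_derivative_transform_within_open[of _ _ _ "{?a<..<?b}"])
    fix u assume "u \<in> {?a<..<?b}"
    then show "primitive g ?a + integral {?a..u} g = primitive g u"
      using primitive_diff[OF continuous_imp_locally_integrable[OF g], of ?a u]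
      by (simp add: algebra_simps)
  qed auto
qed

text \<open>Both sides are absolutely continuous with the same derivative almost everywhere, so
  their difference is constant.\<close>

lemma locally_abs_continuous_eq_primitive:
  assumes f: "locally_abs_continuous f" and g: "locally_integrable g"
    and fg: "AE x in lebesgue. (f has_vector_derivative g x) (at x)"
  shows "f x = f 0 + primitive g x"
proof -
  have "f x - primitive g x = f 0 - primitive g 0"
  proof (rule locally_abs_continuous_derivative_zero)
    show "locally_abs_continuous (\<lambda>x. f x - primitive g x)"
      by (intro locally_abs_continuous_diff f locally_abs_continuous_primitive g)
    show "AE x in lebesgue. ((\<lambda>x. f x - primitive g x) has_vector_derivative 0) (at x)"
      using fg AE_primitive_has_vector_derivative[OF g]
      by eventually_elim (auto intro!: derivative_eq_intros)
  qed
  then show ?thesis by (simp add: algebra_simps)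
qed

text \<open>The Wronskian contains the solutions themselves besides their derivatives, and this
  makes them absolutely continuous as well. The derivative exists everywhere, so \<open>f\<close>
  and \<open>primitive f'\<close> differ by a constant by the ordinary mean value argument.\<close>

lemma C1_imp_locally_abs_continuous:
  assumes "\<And>x. (f has_vector_derivative f' x) (at x)" "continuous_on UNIV f'"
  shows "locally_abs_continuous f"
proof -
  have "f x = f 0 + primitive f' x" for x
  proof -
    have "((\<lambda>x. f x - primitive f' x) has_vector_derivative f' x - f' x) (at x)" for x
      by (intro has_vector_derivative_diff assms(1) primitive_continuous_has_vector_derivative assms(2))
    then have "((\<lambda>x. f x - primitive f' x) has_vector_derivative 0) (at x within UNIV)" for x
      by simp
    from has_vector_derivative_zero_constant[OF convex_UNIV this]
    obtain c where c: "\<And>x. f x - primitive f' x = c" by (metis UNIV_I)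
    show ?thesis using c[of x] c[of 0] by (simp add: algebra_simps)
  qed
  then have "f = (\<lambda>x. f 0 + primitive f' x)" by blast
  then show ?thesis
    using locally_abs_continuous_add[OF locally_abs_continuous_const
        locally_abs_continuous_primitive[OF continuous_imp_locally_integrable[OF assms(2)]], of "f 0"]
    by simp
qed

section \<open>The iterated integrals\<close>

definition alt_factor :: "(real \<Rightarrow> complex) \<Rightarrow> (real \<Rightarrow> complex) \<Rightarrow> nat \<Rightarrow> real \<Rightarrow> complex" where
  "alt_factor u v j = (if odd j then u else v)"

lemma alt_prod_Suc: "alt_prod u v (Suc j) s = alt_prod u v j s * alt_factor u v (Suc j) (s (Suc j))"
  by (simp add: alt_prod_def alt_factor_def)

lemma alt_prod_eq_prod: "alt_prod u v j s = (\<Prod>i=1..j. alt_factor u v i (s i))"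
  unfolding alt_prod_def alt_factor_def by (intro prod.cong) auto

text \<open>
  The sign \<open>\<sigma>\<close> is \<open>1\<close> for \<open>x \<ge> 0\<close> and \<open>-1\<close> for \<open>x < 0\<close>, so that both cases of \<^const>\<open>iter_int\<close> are
  treated at once. Requiring \<open>0 < \<sigma> * s i\<close> for all \<open>i\<close>, not only for \<open>i = 1\<close>, makes the recursion
  over \<open>j\<close> hold from \<open>j = 0\<close> on.
\<close>

definition ordered_simplex :: "real \<Rightarrow> nat \<Rightarrow> real \<Rightarrow> (nat \<Rightarrow> real) set" where
  "ordered_simplex \<sigma> j x = {s. (\<forall>i\<in>{1..j}. 0 < \<sigma> * s i) \<and> (\<forall>i\<in>{1..<j}. \<sigma> * s i < \<sigma> * s (Suc i)) \<and>
     (j \<noteq> 0 \<longrightarrow> \<sigma> * s j < \<sigma> * x)}"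

definition simplex_int :: "real \<Rightarrow> nat \<Rightarrow> (real \<Rightarrow> complex) \<Rightarrow> (real \<Rightarrow> complex) \<Rightarrow> real \<Rightarrow> complex" where
  "simplex_int \<sigma> j u v x =
     (LINT s:ordered_simplex \<sigma> j x | Pi\<^sub>M {1..j} (\<lambda>_. lebesgue). alt_prod u v j s)"

text \<open>The last coordinate takes over the role of \<open>x\<close> for the remaining ones. This
  is the slicing of the simplex to which Fubini is applied.\<close>

lemma ordered_simplex_Suc:
  "s \<in> ordered_simplex \<sigma> (Suc j) x \<longleftrightarrow>
     0 < \<sigma> * s (Suc j) \<and> \<sigma> * s (Suc j) < \<sigma> * x \<and> s \<in> ordered_simplex \<sigma> j (s (Suc j))"
  by (auto simp: ordered_simplex_def le_Suc_eq less_Suc_eq)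

lemma ordered_simplex_bound:
  assumes "s \<in> ordered_simplex \<sigma> j x" "i \<in> {1..j}"
  shows "0 < \<sigma> * s i \<and> \<sigma> * s i < \<sigma> * x"
  using assms
proof (induction j arbitrary: x)
  case (Suc j)
  then show ?case
    by (cases "i = Suc j") (fastforce simp: ordered_simplex_Suc)+
qed simp

lemma ordered_simplex_cong: "(\<And>i. i \<in> {1..j} \<Longrightarrow> s i = t i) \<Longrightarrow> s \<in> ordered_simplex \<sigma> j x \<longleftrightarrow> t \<in> ordered_simplex \<sigma> j x"
  unfolding ordered_simplex_def by (cases j) auto

text \<open>Positivity of the first coordinate passes up the increasing chain; this identifies the
  simplex with the domains of integration in \<open>iter_int\<close>.\<close>

lemma ordered_simplex_first_positive:
  assumes "j \<noteq> 0"
  shows "ordered_simplex \<sigma> j x = {s. 0 < \<sigma> * s 1 \<and> (\<forall>i\<in>{1..<j}. \<sigma> * s i < \<sigma> * s (Suc i)) \<and> \<sigma> * s j < \<sigma> * x}"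
    (is "_ = ?S")
proof (intro equalityI subsetI)
  fix s assume s: "s \<in> ?S"
  have "0 < \<sigma> * s i" if "1 \<le> i" "i \<le> j" for i
    using that
  proof (induction i rule: dec_induct)
    case (step i)
    then have "0 < \<sigma> * s i" "\<sigma> * s i < \<sigma> * s (Suc i)" using s by auto
    then show ?case by linarith
  qed (use s in simp)
  with s show "s \<in> ordered_simplex \<sigma> j x" by (simp add: ordered_simplex_def)
qed (use assms in \<open>auto simp: ordered_simplex_def\<close>)

section \<open>Fubini on the simplex and the recursion for the iterated integrals\<close>

lemma sigma_finite_lebesgue: "sigma_finite_measure (lebesgue :: 'a::euclidean_space measure)"
proof
  obtain A :: "'a set set" where A: "countable A" "A \<subseteq> sets lborel" "\<Union>A = space lborel"
    "\<forall>a\<in>A. emeasure lborel a \<noteq> \<infinity>"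
    using lborel.sigma_finite_countable by blast
  \<comment> \<open>A countable cover by Borel sets of finite measure serves the completion too,
    since both measures agree on Borel sets.\<close>
  then show "\<exists>A::'a set set. countable A \<and> A \<subseteq> sets lebesgue \<and> \<Union>A = space lebesgue \<and>
      (\<forall>a\<in>A. emeasure lebesgue a \<noteq> \<infinity>)"
    by (intro exI[of _ A]) (auto simp: subset_eq)
qed

interpretation lebesgue_prod: product_sigma_finite "\<lambda>_::nat. lebesgue :: real measure"
  by (simp add: product_sigma_finite_def sigma_finite_lebesgue)

lemma iter_int_eq_simplex_int:
  shows "0 \<le> x \<Longrightarrow> iter_int j u v x = simplex_int 1 j u v x"
    and "x < 0 \<Longrightarrow> iter_int j u v x = (- 1) ^ j * simplex_int (- 1) j u v x"
proof -
  \<comment> \<open>The product over the empty index set is a one-point space of mass 1, the simplex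
    is everything and the product is empty, in accordance with \<open>A\<^sub>0 = 1\<close>.\<close>
  have "simplex_int \<sigma> 0 u v x = 1" for \<sigma>
    using lebesgue_prod.product_integral_prod[of "{}" "\<lambda>_ _. 1 :: complex"]
    by (simp add: simplex_int_def ordered_simplex_def alt_prod_def set_lebesgue_integral_def)
  then show "0 \<le> x \<Longrightarrow> iter_int j u v x = simplex_int 1 j u v x"
    and "x < 0 \<Longrightarrow> iter_int j u v x = (- 1) ^ j * simplex_int (- 1) j u v x"
    by (cases "j = 0"; simp add: iter_int_def simplex_int_def ordered_simplex_first_positive conj_ac)+
qed

lemma borel_measurable_PiM_lebesgue_component:
  "i \<in> I \<Longrightarrow> (\<lambda>s. s i) \<in> borel_measurable (Pi\<^sub>M I (\<lambda>_. lebesgue :: real measure))"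
  using measurable_compose[OF measurable_component_singleton[of i I "\<lambda>_. lebesgue"], of id borel]
  by simp

lemma ordered_simplex_sets:
  "ordered_simplex \<sigma> j x \<inter> space (Pi\<^sub>M {1..j} (\<lambda>_. lebesgue)) \<in> sets (Pi\<^sub>M {1..j} (\<lambda>_. lebesgue))"
proof -
  let ?M = "Pi\<^sub>M {1..j} (\<lambda>_. lebesgue :: real measure)"
  note [measurable] = borel_measurable_PiM_lebesgue_component
  have m: "(\<lambda>s. \<sigma> * s i) \<in> borel_measurable ?M" if "i \<in> {1..j}" for i
    using that by measurable
  have "Measurable.pred ?M (\<lambda>s. (\<forall>i\<in>{1..j}. 0 < \<sigma> * s i) \<and>
      (\<forall>i\<in>{1..<j}. \<sigma> * s i < \<sigma> * s (Suc i)) \<and> (j \<noteq> 0 \<longrightarrow> \<sigma> * s j < \<sigma> * x))"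
  proof (cases "j = 0")
    case False
    then have "Measurable.pred ?M (\<lambda>s. (\<forall>i\<in>{1..j}. 0 < \<sigma> * s i) \<and>
        (\<forall>i\<in>{1..<j}. \<sigma> * s i < \<sigma> * s (Suc i)) \<and> \<sigma> * s j < \<sigma> * x)"
      by (intro pred_intros_logic pred_intros_finite borel_measurable_pred_less m
          borel_measurable_const) auto
    with False show ?thesis by simp
  qed simp
  then have "{s \<in> space ?M. s \<in> ordered_simplex \<sigma> j x} \<in> sets ?M"
    unfolding ordered_simplex_def mem_Collect_eq by (rule predE)
  moreover have "{s \<in> space ?M. s \<in> ordered_simplex \<sigma> j x} = ordered_simplex \<sigma> j x \<inter> space ?M" by auto
  ultimately show ?thesis by simp
qed

lemma alt_factor_locally_integrable:
  "locally_integrable u \<Longrightarrow> locally_integrable v \<Longrightarrow> locally_integrable (alt_factor u v j)"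
  by (simp add: alt_factor_def)

text \<open>On the simplex all coordinates lie in \<open>{-\<bar>x\<bar>..\<bar>x\<bar>}\<close>.
  The integrand is thus an indicator times a product of integrable functions of one variable
  each.\<close>

lemma integrable_ordered_simplex:
  assumes u: "locally_integrable u" and v: "locally_integrable v" and \<sigma>: "\<bar>\<sigma>\<bar> = 1"
  shows "integrable (Pi\<^sub>M {1..j} (\<lambda>_. lebesgue)) (\<lambda>s. indicator (ordered_simplex \<sigma> j x) s *\<^sub>R alt_prod u v j s)"
proof -
  let ?M = "Pi\<^sub>M {1..j} (\<lambda>_. lebesgue :: real measure)"
  let ?g = "\<lambda>i t. indicator {-\<bar>x\<bar>..\<bar>x\<bar>} t *\<^sub>R alt_factor u v i t"
  have "integrable ?M (\<lambda>s. \<Prod>i\<in>{1..j}. ?g i (s i))"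
  proof (rule lebesgue_prod.product_integrable_prod)
    show "integrable lebesgue (?g i)" for i
      using locally_integrableD(1)[OF alt_factor_locally_integrable[OF u v, of i],
          where a = "-\<bar>x\<bar>" and b = "\<bar>x\<bar>"]
      by (simp add: set_integrable_def)
  qed simp
  then have "integrable ?M (\<lambda>s. indicator (ordered_simplex \<sigma> j x \<inter> space ?M) s *\<^sub>R (\<Prod>i\<in>{1..j}. ?g i (s i)))"
    by (rule integrable_mult_indicator[OF ordered_simplex_sets])
  moreover have "indicator (ordered_simplex \<sigma> j x \<inter> space ?M) s *\<^sub>R (\<Prod>i\<in>{1..j}. ?g i (s i))
      = indicator (ordered_simplex \<sigma> j x) s *\<^sub>R alt_prod u v j s" if "s \<in> space ?M" for s
  proof (cases "s \<in> ordered_simplex \<sigma> j x")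
    case True
    have "s i \<in> {-\<bar>x\<bar>..\<bar>x\<bar>}" if "i \<in> {1..j}" for i
    proof -
      have "\<bar>\<sigma> * s i\<bar> \<le> \<bar>\<sigma> * x\<bar>" using ordered_simplex_bound[OF True that] by linarith
      then show ?thesis using \<sigma> by (auto simp: abs_mult)
    qed
    then have "(\<Prod>i\<in>{1..j}. ?g i (s i)) = alt_prod u v j s"
      unfolding alt_prod_eq_prod by (intro prod.cong) auto
    with that show ?thesis by (simp add: indicator_def)
  qed simp
  ultimately show ?thesis
    using Bochner_Integration.integrable_cong[OF refl] by (metis (mono_tags, lifting))
qed

text \<open>Fubini with the last coordinate as the outer variable. Measurability of the outer
  integrand is kept as the hypothesis \<open>meas\<close>, to be supplied by continuity of the lower
  iterated integral.\<close>

lemma simplex_int_Suc: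
  assumes u: "locally_integrable u" and v: "locally_integrable v" and \<sigma>: "\<bar>\<sigma>\<bar> = 1"
    and meas: "(\<lambda>t. indicator {t. 0 < \<sigma> * t \<and> \<sigma> * t < \<sigma> * x} t *\<^sub>R
      (alt_factor u v (Suc j) t * simplex_int \<sigma> j u v t)) \<in> borel_measurable lebesgue"
  shows "simplex_int \<sigma> (Suc j) u v x =
    (LINT t:{t. 0 < \<sigma> * t \<and> \<sigma> * t < \<sigma> * x} | lebesgue.
       alt_factor u v (Suc j) t * simplex_int \<sigma> j u v t)"
proof -
  let ?L = "\<lambda>_::nat. lebesgue :: real measure"
  let ?D = "{t. 0 < \<sigma> * t \<and> \<sigma> * t < \<sigma> * x}"
  let ?f = "\<lambda>s. indicator (ordered_simplex \<sigma> (Suc j) x) s *\<^sub>R alt_prod u v (Suc j) s"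
  let ?G = "\<lambda>t. indicator ?D t *\<^sub>R (alt_factor u v (Suc j) t * simplex_int \<sigma> j u v t)"
  have un: "{Suc j} \<union> {1..j} = {1..Suc j}" by auto
  have merge: "?f (merge {Suc j} {1..j} (p, y)) =
      indicator ?D (p (Suc j)) *\<^sub>R alt_factor u v (Suc j) (p (Suc j)) *
        (indicator (ordered_simplex \<sigma> j (p (Suc j))) y *\<^sub>R alt_prod u v j y)" for p y
  proof -
    let ?s = "merge {Suc j} {1..j} (p, y)"
    have s: "?s (Suc j) = p (Suc j)" "\<And>i. i \<in> {1..j} \<Longrightarrow> ?s i = y i"
      by (auto simp: merge_def)
    have "alt_prod u v j ?s = alt_prod u v j y"
      unfolding alt_prod_eq_prod using s(2) by (intro prod.cong) auto
    moreover have "?s \<in> ordered_simplex \<sigma> j t \<longleftrightarrow> y \<in> ordered_simplex \<sigma> j t" for t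
      by (intro ordered_simplex_cong s(2))
    ultimately show ?thesis
      by (auto simp: indicator_def ordered_simplex_Suc alt_prod_Suc s(1))
  qed
  have "simplex_int \<sigma> (Suc j) u v x = integral\<^sup>L (Pi\<^sub>M ({Suc j} \<union> {1..j}) ?L) ?f"
    unfolding simplex_int_def set_lebesgue_integral_def un ..
  also have "\<dots> = (\<integral>p. (\<integral>y. ?f (merge {Suc j} {1..j} (p, y)) \<partial>Pi\<^sub>M {1..j} ?L) \<partial>Pi\<^sub>M {Suc j} ?L)"
  proof (rule lebesgue_prod.product_integral_fold)
    show "integrable (Pi\<^sub>M ({Suc j} \<union> {1..j}) ?L) ?f"
      unfolding un by (rule integrable_ordered_simplex[OF u v \<sigma>])
  qed auto
  also have "\<dots> = (\<integral>p. ?G (p (Suc j)) \<partial>Pi\<^sub>M {Suc j} ?L)"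
    unfolding merge simplex_int_def set_lebesgue_integral_def integral_mult_right_zero
    by (simp only: mult_scaleR_left)
  also have "\<dots> = integral\<^sup>L lebesgue ?G"
    by (rule lebesgue_prod.product_integral_singleton[OF meas])
  finally show ?thesis unfolding set_lebesgue_integral_def .
qed

text \<open>Continuity of \<open>iter_int j u v\<close> makes the integrand locally integrable,
  which gives both the measurability that Fubini asks for and the passage from the Lebesgue to the
  gauge integral.\<close>

lemma iter_int_Suc_of_continuous:
  assumes u: "locally_integrable u" and v: "locally_integrable v"
    and cont: "continuous_on UNIV (iter_int j u v)"
  shows "iter_int (Suc j) u v x = primitive (\<lambda>t. alt_factor u v (Suc j) t * iter_int j u v t) x"
proof -
  let ?h = "\<lambda>t. alt_factor u v (Suc j) t * iter_int j u v t"
  have h: "locally_integrable ?h"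
    by (intro locally_integrable_mult_continuous alt_factor_locally_integrable u v cont)
  have hs: "set_integrable lebesgue {a<..<b} ?h" for a b
    by (rule set_integrable_subset[OF locally_integrableD(1)[OF h, of a b]]) auto
  have int: "(LINT t:{a<..<b} | lebesgue. ?h t) = integral {a..b} ?h" for a b
    using set_lebesgue_integral_eq_integral(2)[OF hs] by (simp add: integral_open_interval_real)
  show ?thesis
  proof (cases "0 \<le> x")
    case True
    have D: "{t. 0 < 1 * t \<and> 1 * t < 1 * x} = {0<..<x}" by auto
    have eq: "indicator {0<..<x} t *\<^sub>R (alt_factor u v (Suc j) t * simplex_int 1 j u v t)
        = indicator {0<..<x} t *\<^sub>R ?h t" for t
      by (auto simp: indicator_def iter_int_eq_simplex_int(1))
    have "iter_int (Suc j) u v x = simplex_int 1 (Suc j) u v x"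
      using True by (rule iter_int_eq_simplex_int(1))
    also have "\<dots> = (LINT t:{0<..<x} | lebesgue. alt_factor u v (Suc j) t * simplex_int 1 j u v t)"
      using simplex_int_Suc[OF u v, of 1 x j] hs[of 0 x] unfolding D eq set_integrable_def by simp
    also have "\<dots> = (LINT t:{0<..<x} | lebesgue. ?h t)"
      unfolding set_lebesgue_integral_def eq ..
    finally show ?thesis using True by (simp add: int primitive_def)
  next
    case False
    have D: "{t. 0 < - 1 * t \<and> - 1 * t < - 1 * x} = {x<..<0}" by auto
    have eq: "indicator {x<..<0} t *\<^sub>R (alt_factor u v (Suc j) t * simplex_int (- 1) j u v t)
        = (- 1) ^ j * (indicator {x<..<0} t *\<^sub>R ?h t)" for t
      by (auto simp: indicator_def iter_int_eq_simplex_int(2) power_mult_distrib[symmetric]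
          mult.left_commute[of "(- 1) ^ j"] simp flip: mult.assoc)
    have "integrable lebesgue (\<lambda>t. (- 1) ^ j * (indicator {x<..<0} t *\<^sub>R ?h t))"
      using hs[of x 0] unfolding set_integrable_def by (intro integrable_mult_right)
    then have "simplex_int (- 1) (Suc j) u v x =
        (LINT t:{x<..<0} | lebesgue. alt_factor u v (Suc j) t * simplex_int (- 1) j u v t)"
      using simplex_int_Suc[OF u v, of "-1" x j] unfolding D eq by simp
    also have "\<dots> = (- 1) ^ j * (LINT t:{x<..<0} | lebesgue. ?h t)"
      unfolding set_lebesgue_integral_def eq by (rule integral_mult_right_zero)
    \<comment> \<open>The two sign factors multiply to \<open>- 1\<close>, which is the orientation
      sign of \<open>primitive\<close> to the left of 0.\<close>
    finally have "iter_int (Suc j) u v x = (- 1) ^ Suc j * ((- 1) ^ j * integral {x..0} ?h)"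
      using False by (simp only: iter_int_eq_simplex_int(2) not_le int)
    then show ?thesis using False by (simp add: primitive_def flip: mult.assoc power_mult_distrib)
  qed
qed

text \<open>Continuity at level \<open>j\<close> unlocks the recursion, and the recursion presents
  level \<open>Suc j\<close> as a primitive, which is continuous.\<close>

lemma continuous_on_iter_int:
  assumes u: "locally_integrable u" and v: "locally_integrable v"
  shows "continuous_on UNIV (iter_int j u v)"
proof (induction j)
  case 0 then show ?case by (simp add: iter_int_def[abs_def])
next
  case (Suc j)
  have "iter_int (Suc j) u v = primitive (\<lambda>t. alt_factor u v (Suc j) t * iter_int j u v t)"
    using iter_int_Suc_of_continuous[OF u v Suc] by blast
  then show ?case
    by (simp add: continuous_on_primitive locally_integrable_mult_continuous Suc
        alt_factor_locally_integrable u v)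
qed

lemma iter_int_Suc:
  assumes u: "locally_integrable u" and v: "locally_integrable v"
  shows "iter_int (Suc j) u v x = primitive (\<lambda>t. alt_factor u v (Suc j) t * iter_int j u v t) x"
  by (rule iter_int_Suc_of_continuous[OF u v continuous_on_iter_int[OF u v]])

section \<open>The series and their integral equations\<close>

lemma has_vector_derivative_power:
  fixes f :: "real \<Rightarrow> 'a::real_normed_field"
  assumes "(f has_vector_derivative f') (at x)"
  shows "((\<lambda>x. f x ^ Suc n) has_vector_derivative of_nat (Suc n) * f x ^ n * f') (at x)"
proof (induction n)
  case (Suc n)
  have eq: "f x * (of_nat (Suc n) * f x ^ n * f') + f' * f x ^ Suc n
      = of_nat (Suc (Suc n)) * f x ^ Suc n * f'"
    by (simp add: algebra_simps)
  show ?case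
    using has_vector_derivative_mult[OF assms Suc] unfolding eq power_Suc[where n = "Suc n"] .
qed (use assms in simp)

text \<open>The substitution rule for a merely integrable \<open>h\<close>, obtained by comparing
  derivatives almost everywhere. Each use contributes one factor of the factorial.\<close>

lemma primitive_mult_primitive_power:
  assumes h: "locally_integrable h"
  shows "primitive (\<lambda>t. h t * primitive h t ^ n) x = primitive h x ^ Suc n / of_nat (Suc n)"
proof -
  let ?f = "\<lambda>x. inverse (of_nat (Suc n)) * primitive h x ^ Suc n"
  have "?f x = ?f 0 + primitive (\<lambda>t. h t * primitive h t ^ n) x"
  proof (rule locally_abs_continuous_eq_primitive)
    show "locally_abs_continuous ?f"
      by (intro locally_abs_continuous_mult locally_abs_continuous_const
          locally_abs_continuous_power locally_abs_continuous_primitive h)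
    show "locally_integrable (\<lambda>t. h t * primitive h t ^ n)"
      by (intro locally_integrable_mult_continuous h continuous_on_power continuous_on_primitive)
    show "AE x in lebesgue. (?f has_vector_derivative h x * primitive h x ^ n) (at x)"
      using AE_primitive_has_vector_derivative[OF h]
    proof eventually_elim
      case (elim x)
      have eq: "inverse (of_nat (Suc n)) * (of_nat (Suc n) * primitive h x ^ n * h x)
          = h x * primitive h x ^ n"
        by (simp add: field_simps del: of_nat_Suc)
      show ?case
        using has_vector_derivative_mult_right[OF has_vector_derivative_power[OF elim, of n],
          of "inverse (of_nat (Suc n))"]
        unfolding eq .
    qed
  qed
  then show ?thesis by (simp add: field_simps del: of_nat_Suc)
qed

text \<open>On either half line the primitive equals its norm up to a fixed sign, so powers of the
  norm can be integrated as powers of the primitive.\<close>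

lemma primitive_of_real:
  assumes "\<And>a b. h integrable_on {a..b}" "\<And>t. 0 \<le> h t"
  shows "0 \<le> x \<Longrightarrow> primitive (\<lambda>t. complex_of_real (h t)) x
      = of_real (norm (primitive (\<lambda>t. complex_of_real (h t)) x))"
    and "x \<le> 0 \<Longrightarrow> primitive (\<lambda>t. complex_of_real (h t)) x
      = - of_real (norm (primitive (\<lambda>t. complex_of_real (h t)) x))"
proof -
  have "integral {a..b} (\<lambda>t. complex_of_real (h t)) = of_real (integral {a..b} h)" for a b
    using has_integral_of_real[OF integrable_integral[OF assms(1)]] by (rule integral_unique)
  moreover have "0 \<le> integral {a..b} h" for a b
    by (rule Henstock_Kurzweil_Integration.integral_nonneg) (use assms in auto)
  ultimately show "0 \<le> x \<Longrightarrow> primitive (\<lambda>t. complex_of_real (h t)) x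
      = of_real (norm (primitive (\<lambda>t. complex_of_real (h t)) x))"
    and "x \<le> 0 \<Longrightarrow> primitive (\<lambda>t. complex_of_real (h t)) x
      = - of_real (norm (primitive (\<lambda>t. complex_of_real (h t)) x))"
    by (auto simp: primitive_def)
qed

lemma locally_integrable_norm_add:
  assumes "locally_integrable u" "locally_integrable v"
  shows "locally_integrable (\<lambda>t. complex_of_real (norm (u t) + norm (v t)))"
proof -
  have i: "(\<lambda>t. norm (u t) + norm (v t)) integrable_on {a..b}" for a b
    using assms by (intro integrable_add locally_integrableD(3))
  from has_integral_of_real[OF integrable_integral[OF i]]
  have "(\<lambda>t. complex_of_real (norm (u t) + norm (v t))) integrable_on {a..b}" for a b
    unfolding integrable_on_def by blast
  with i show ?thesis
    unfolding locally_integrable_iff absolutely_integrable_on_def by (simp del: of_real_add)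
qed

text \<open>Inserting the bound for \<open>j\<close> into the recursion leaves an integral of
  \<open>norm (u t) + norm (v t)\<close> times a power of \<open>norm (primitive h t)\<close>. Up to
  sign this is \<open>h t * primitive h t ^ j\<close>, whose primitive is explicit. The density
  \<open>h\<close> is complex valued so that the results on \<open>primitive\<close> apply to
  it.\<close>

lemma norm_iter_int_le:
  assumes u: "locally_integrable u" and v: "locally_integrable v"
  defines "h \<equiv> \<lambda>t. complex_of_real (norm (u t) + norm (v t))"
  shows "norm (iter_int j u v x) \<le> norm (primitive h x) ^ j / fact j"
proof (induction j arbitrary: x)
  case 0 then show ?case by (simp add: iter_int_def)
next
  case (Suc j)
  have hr: "(\<lambda>t. norm (u t) + norm (v t)) integrable_on {a..b}" for a b
    using locally_integrableD(3)[OF u] locally_integrableD(3)[OF v] by (rule integrable_add)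
  have h: "locally_integrable h"
    unfolding h_def by (rule locally_integrable_norm_add[OF u v])
  let ?M = "primitive h"
  let ?f = "\<lambda>t. alt_factor u v (Suc j) t * iter_int j u v t"
  have f: "locally_integrable ?f"
    by (intro locally_integrable_mult_continuous alt_factor_locally_integrable
        continuous_on_iter_int u v)
  have G: "locally_integrable (\<lambda>t. h t * ?M t ^ j)"
    by (intro locally_integrable_mult_continuous h continuous_on_power continuous_on_primitive)
  have fle: "norm (?f t) \<le> (norm (u t) + norm (v t)) * (norm (?M t) ^ j / fact j)" for t
    unfolding norm_mult by (intro mult_mono Suc) (auto simp: alt_factor_def)
  have pos: "?M t = of_real (norm (?M t))" if "0 \<le> t" for t
    using primitive_of_real(1)[OF hr _ that] unfolding h_def by simp
  have neg: "?M t = - of_real (norm (?M t))" if "t \<le> 0" for t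
    using primitive_of_real(2)[OF hr _ that] unfolding h_def by simp
  \<comment> \<open>The constant \<open>c\<close> is the sign relating the powers of the norm to
    those of \<open>?M\<close>: 1 on the right half line, \<open>(- 1) ^ j\<close> on the
    left.\<close>
  have key: "norm (integral {a..b} ?f) \<le> Re (c / fact j * integral {a..b} (\<lambda>t. h t * ?M t ^ j))"
    if c: "\<And>t. t \<in> {a..b} \<Longrightarrow> of_real (norm (?M t) ^ j) = c * ?M t ^ j" for a b c
  proof -
    \<comment> \<open>The inner product with 1 is the real part, which turns the complex majorant
      into a real bound.\<close>
    have "norm (integral {a..b} ?f) \<le> integral {a..b} (\<lambda>t. c / fact j * (h t * ?M t ^ j)) \<bullet> 1"
    proof (rule integral_norm_bound_integral_component)
      fix t assume "t \<in> {a..b}"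
      have "c / fact j * (h t * ?M t ^ j) = h t * (c * ?M t ^ j) / fact j" by simp
      also have "\<dots> = of_real ((norm (u t) + norm (v t)) * (norm (?M t) ^ j / fact j))"
        unfolding c[OF \<open>t \<in> {a..b}\<close>, symmetric] by (simp add: h_def)
      finally show "norm (?f t) \<le> (c / fact j * (h t * ?M t ^ j)) \<bullet> 1"
        using fle[of t] by (simp only: inner_complex_def Re_complex_of_real Im_complex_of_real
            one_complex.sel mult_1_right mult_zero_left add_0_right)
    next
      show "(\<lambda>t. c / fact j * (h t * ?M t ^ j)) integrable_on {a..b}"
        by (rule integrable_on_mult_right[OF locally_integrableD(2)[OF G]])
    qed (rule locally_integrableD(2)[OF f])
    then show ?thesis by (simp add: inner_complex_def)
  qed
  have it: "iter_int (Suc j) u v x = primitive ?f x" by (rule iter_int_Suc[OF u v])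
  note pp = primitive_mult_primitive_power[OF h, of j x]
  have fin: "1 / fact j * (complex_of_real (norm (?M x)) ^ Suc j / of_nat (Suc j))
      = of_real (norm (?M x) ^ Suc j / fact (Suc j))"
    by (simp add: field_simps)
  show ?case
  proof (cases "0 \<le> x")
    case True
    have "of_real (norm (?M t) ^ j) = 1 * ?M t ^ j" if "t \<in> {0..x}" for t
      using pos[of t] that by (metis atLeastAtMost_iff mult_1 of_real_power)
    from key[OF this] have "norm (primitive ?f x)
        \<le> Re (1 / fact j * primitive (\<lambda>t. h t * ?M t ^ j) x)"
      using True by (simp add: primitive_def)
    also have "1 / fact j * primitive (\<lambda>t. h t * ?M t ^ j) x
        = of_real (norm (?M x) ^ Suc j / fact (Suc j))"
      unfolding pp using fin pos[OF True] by metis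
    finally show ?thesis by (simp only: it Re_complex_of_real)
  next
    case False
    have mp: "of_real (norm (?M t)) ^ n = (- 1) ^ n * ?M t ^ n" if "t \<le> 0" for t n
    proof -
      have "of_real (norm (?M t)) = - 1 * ?M t" using neg[OF that] by (metis minus_equation_iff mult_minus1)
      then show ?thesis by (simp only: power_mult_distrib)
    qed
    have "of_real (norm (?M t) ^ j) = (- 1) ^ j * ?M t ^ j" if "t \<in> {x..0}" for t
      using mp[of t j] that by simp
    from key[OF this] have "norm (primitive ?f x)
        \<le> Re (((- 1) ^ j / fact j) * (- primitive (\<lambda>t. h t * ?M t ^ j) x))"
      using False by (simp add: primitive_def)
    \<comment> \<open>The orientation sign of \<open>primitive\<close> raises the exponent of
      \<open>- 1\<close> to \<open>Suc j\<close>, just what the power \<open>?M x ^ Suc j\<close>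
      needs to become a power of the norm.\<close>
    also have "((- 1) ^ j / fact j) * (- primitive (\<lambda>t. h t * ?M t ^ j) x)
        = 1 / fact j * ((- 1) ^ Suc j * ?M x ^ Suc j / of_nat (Suc j))"
      unfolding pp by simp
    also have "\<dots> = of_real (norm (?M x) ^ Suc j / fact (Suc j))"
      using False by (subst mp[symmetric], simp) (rule fin)
    finally show ?thesis by (simp only: it Re_complex_of_real)
  qed
qed

lemma norm_iter_int_le_compact:
  assumes u: "locally_integrable u" and v: "locally_integrable v"
  obtains b where "summable b" "\<And>j t. \<bar>t\<bar> \<le> X \<Longrightarrow> norm (iter_int j u v t) \<le> b j"
proof -
  define h where "h = (\<lambda>t. complex_of_real (norm (u t) + norm (v t)))"
  have "locally_integrable h"
    unfolding h_def by (rule locally_integrable_norm_add[OF u v])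
  then have "bounded (primitive h ` {-X..X})"
    by (intro compact_imp_bounded compact_continuous_image continuous_on_primitive) auto
  then obtain B where "\<forall>z\<in>primitive h ` {-X..X}. norm z \<le> B"
    unfolding bounded_iff by blast
  then have B: "norm (primitive h t) \<le> B" if "t \<in> {-X..X}" for t
    using that by blast
  show ?thesis
  proof
    show "summable (\<lambda>j. inverse (fact j) * B ^ j)" by (rule summable_exp)
    fix j t assume t: "\<bar>t\<bar> \<le> X"
    have "norm (iter_int j u v t) \<le> norm (primitive h t) ^ j / fact j"
      unfolding h_def by (rule norm_iter_int_le[OF u v])
    also have "\<dots> \<le> B ^ j / fact j"
      using B[of t] t by (intro divide_right_mono power_mono) (auto simp: abs_le_iff)
    finally show "norm (iter_int j u v t) \<le> inverse (fact j) * B ^ j"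
      by (simp add: field_simps)
  qed
qed

section \<open>Series with locally uniform majorants\<close>

definition locally_M_bounded :: "(nat \<Rightarrow> real \<Rightarrow> complex) \<Rightarrow> bool" where
  "locally_M_bounded f \<longleftrightarrow> (\<forall>X. \<exists>b. summable b \<and> (\<forall>n t. \<bar>t\<bar> \<le> X \<longrightarrow> norm (f n t) \<le> b n))"

lemma locally_M_boundedE:
  assumes "locally_M_bounded f"
  obtains b where "summable b" "\<And>n t. \<bar>t\<bar> \<le> X \<Longrightarrow> norm (f n t) \<le> b n"
  using assms unfolding locally_M_bounded_def by meson

lemma locally_M_bounded_summable: "locally_M_bounded f \<Longrightarrow> summable (\<lambda>n. f n t)"
  by (erule locally_M_boundedE[of _ "\<bar>t\<bar>"]) (rule summable_comparison_test', auto)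

lemma continuous_on_suminf_locally_M_bounded:
  assumes f: "locally_M_bounded f" and c: "\<And>n. continuous_on UNIV (f n)"
  shows "continuous_on UNIV (\<lambda>t. \<Sum>n. f n t)"
proof -
  have "isCont (\<lambda>t. \<Sum>n. f n t) x" for x
  proof -
    let ?A = "{-\<bar>x\<bar> - 1..\<bar>x\<bar> + 1}"
    obtain b where b: "summable b" "\<And>n t. \<bar>t\<bar> \<le> \<bar>x\<bar> + 1 \<Longrightarrow> norm (f n t) \<le> b n"
      using locally_M_boundedE[OF f] by blast
    have "uniform_limit ?A (\<lambda>n x. \<Sum>i<n. f i x) (\<lambda>x. \<Sum>i. f i x) sequentially"
      by (rule Weierstrass_m_test[OF b(2,1)]) auto
    then have "continuous_on ?A (\<lambda>t. \<Sum>n. f n t)"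
      by (rule uniform_limit_theorem[rotated])
        (auto intro!: always_eventually continuous_on_sum continuous_on_subset[OF c])
    then show ?thesis by (rule continuous_on_interior) auto
  qed
  then show ?thesis by (simp add: continuous_at_imp_continuous_on)
qed

text \<open>The factor \<open>u\<close> may be unbounded, so uniform convergence of the partial sums
  does not carry over to the products; dominated convergence with majorant
  \<open>norm (u t) * suminf b\<close> takes its place.\<close>

lemma primitive_sums:
  assumes u: "locally_integrable u" and f: "locally_M_bounded f"
    and c: "\<And>n. continuous_on UNIV (f n)"
  shows "(\<lambda>n. primitive (\<lambda>t. u t * f n t) x) sums primitive (\<lambda>t. u t * (\<Sum>n. f n t)) x"
proof -
  obtain b where b: "summable b" "\<And>n t. \<bar>t\<bar> \<le> \<bar>x\<bar> \<Longrightarrow> norm (f n t) \<le> b n"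
    using locally_M_boundedE[OF f] by blast
  have b0: "0 \<le> b n" for n using b(2)[of 0 n] norm_ge_zero[of "f n 0"] by linarith
  have i: "(\<lambda>t. u t * f n t) integrable_on {p..q}" for n p q
    by (intro locally_integrableD(2) locally_integrable_mult_continuous u c)
  have "(\<lambda>n. integral {p..q} (\<lambda>t. u t * f n t)) sums integral {p..q} (\<lambda>t. u t * (\<Sum>n. f n t))"
    if pq: "{p..q} \<subseteq> {-\<bar>x\<bar>..\<bar>x\<bar>}" for p q
  proof -
    have "(\<lambda>k. integral {p..q} (\<lambda>t. \<Sum>n<k. u t * f n t))
        \<longlonglongrightarrow> integral {p..q} (\<lambda>t. u t * (\<Sum>n. f n t))"
    proof (rule dominated_convergence(2)[where h = "\<lambda>t. norm (u t) * suminf b"])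
      show "(\<lambda>t. norm (u t) * suminf b) integrable_on {p..q}"
        by (intro integrable_on_mult_left locally_integrableD(3) u)
      show "(\<lambda>t. \<Sum>n<k. u t * f n t) integrable_on {p..q}" for k
        by (intro integrable_sum i) auto
      fix t assume "t \<in> {p..q}"
      then have t: "\<bar>t\<bar> \<le> \<bar>x\<bar>" using pq by (auto simp: abs_le_iff)
      show "norm (\<Sum>n<k. u t * f n t) \<le> norm (u t) * suminf b" for k
      proof -
        have "norm (\<Sum>n<k. f n t) \<le> (\<Sum>n<k. b n)"
          using b(2)[OF t] by (rule sum_norm_le)
        also have "\<dots> \<le> suminf b"
          using b(1) b0 by (intro sum_le_suminf) auto
        finally show ?thesis
          by (simp add: sum_distrib_left[symmetric] norm_mult mult_left_mono)
      qed
      show "(\<lambda>k. \<Sum>n<k. u t * f n t) \<longlonglongrightarrow> u t * (\<Sum>n. f n t)"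
        using sums_mult[OF summable_sums[OF locally_M_bounded_summable[OF f]], of "u t" t]
        by (simp add: sums_def)
    qed
    then show ?thesis
      unfolding sums_def by (subst (asm) Henstock_Kurzweil_Integration.integral_sum) (auto intro: i)
  qed
  note * = this
  show ?thesis
  proof (cases "0 \<le> x")
    case True
    then show ?thesis using *[of 0 x] by (simp add: primitive_def)
  next
    case False
    then show ?thesis using sums_minus[OF *[of x 0]] by (simp add: primitive_def)
  qed
qed

section \<open>Even and odd parts of the bivariate exponential\<close>

lemma alt_prod_uminus: "alt_prod (\<lambda>t. - u t) (\<lambda>t. - v t) j s = (- 1) ^ j * alt_prod u v j s"
  by (induction j) (simp_all add: alt_prod_Suc alt_prod_def[of _ _ 0] alt_factor_def)

lemma iter_int_uminus: "iter_int j (\<lambda>t. - u t) (\<lambda>t. - v t) x = (- 1) ^ j * iter_int j u v x"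
proof -
  have "alt_prod (\<lambda>t. - u t) (\<lambda>t. - v t) j = (\<lambda>s. (- 1) ^ j * alt_prod u v j s)"
    by (rule ext) (rule alt_prod_uminus)
  then show ?thesis by (simp add: iter_int_def)
qed

text \<open>Filling the other parity with zeros keeps both series indexed by all \<open>j\<close>.
  They can then be added and subtracted termwise, and the shift from \<open>j\<close> to
  \<open>Suc j\<close> exchanges them.\<close>

definition even_term :: "(real \<Rightarrow> complex) \<Rightarrow> (real \<Rightarrow> complex) \<Rightarrow> nat \<Rightarrow> real \<Rightarrow> complex" where
  "even_term u v j x = (if even j then iter_int j u v x else 0)"

definition odd_term :: "(real \<Rightarrow> complex) \<Rightarrow> (real \<Rightarrow> complex) \<Rightarrow> nat \<Rightarrow> real \<Rightarrow> complex" where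
  "odd_term u v j x = (if odd j then iter_int j u v x else 0)"

context
  fixes u v :: "real \<Rightarrow> complex"
  assumes u: "locally_integrable u" and v: "locally_integrable v"
begin

lemma locally_M_bounded_terms:
  shows "locally_M_bounded (\<lambda>j. iter_int j u v)"
    and "locally_M_bounded (even_term u v)" and "locally_M_bounded (odd_term u v)"
proof -
  have "\<exists>b. summable b \<and> (\<forall>n t. \<bar>t\<bar> \<le> X \<longrightarrow> norm (iter_int n u v t) \<le> b n)" for X
    by (rule norm_iter_int_le_compact[OF u v]) blast
  then show *: "locally_M_bounded (\<lambda>j. iter_int j u v)" by (simp add: locally_M_bounded_def)
  have le: "locally_M_bounded f" if "\<And>n t. norm (f n t) \<le> norm (iter_int n u v t)" for f
    using * that unfolding locally_M_bounded_def by (meson order_trans)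
  show "locally_M_bounded (even_term u v)" "locally_M_bounded (odd_term u v)"
    by (auto intro!: le simp: even_term_def odd_term_def)
qed

lemma continuous_on_terms:
  shows "continuous_on UNIV (even_term u v j)" and "continuous_on UNIV (odd_term u v j)"
  by (cases "even j"; simp add: even_term_def[abs_def] odd_term_def[abs_def]
      continuous_on_iter_int u v)+

lemma biv_exp_eq_suminf:
  "biv_exp u v x = (\<Sum>j. iter_int j u v x)"
  "biv_exp (\<lambda>t. - u t) (\<lambda>t. - v t) x = (\<Sum>j. (- 1) ^ j * iter_int j u v x)"
proof -
  have s: "summable (\<lambda>j. iter_int j u v x)"
    by (rule locally_M_bounded_summable[OF locally_M_bounded_terms(1)])
  have "summable (\<lambda>j. (- 1) ^ j * iter_int j u v x)"
  proof -
    obtain b where b: "summable b" "\<And>n t. \<bar>t\<bar> \<le> \<bar>x\<bar> \<Longrightarrow> norm (iter_int n u v t) \<le> b n"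
      using locally_M_boundedE[OF locally_M_bounded_terms(1)] by blast
    then show ?thesis
      by (intro summable_comparison_test'[OF b(1)]) (simp add: norm_mult norm_power)
  qed
  from suminf_split_head[OF s] suminf_split_head[OF this]
  show "biv_exp u v x = (\<Sum>j. iter_int j u v x)"
    "biv_exp (\<lambda>t. - u t) (\<lambda>t. - v t) x = (\<Sum>j. (- 1) ^ j * iter_int j u v x)"
    by (simp_all only: biv_exp_def iter_int_uminus) (simp_all add: iter_int_def[of 0])
qed

text \<open>Negating both \<open>u\<close> and \<open>v\<close> multiplies \<open>A\<^sub>j\<close>
  by \<open>(- 1) ^ j\<close>, so the half sum keeps the even terms and the half difference the odd
  ones.\<close>

lemma biv_cosh_sinh_eq_suminf:
  "biv_cosh u v x = (\<Sum>j. even_term u v j x)"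
  "biv_sinh u v x = (\<Sum>j. odd_term u v j x)"
proof -
  have e: "summable (\<lambda>j. even_term u v j x)" and o: "summable (\<lambda>j. odd_term u v j x)"
    using locally_M_bounded_summable locally_M_bounded_terms(2,3) by blast+
  have "(\<lambda>j. even_term u v j x + odd_term u v j x) = (\<lambda>j. iter_int j u v x)"
    "(\<lambda>j. even_term u v j x - odd_term u v j x) = (\<lambda>j. (- 1) ^ j * iter_int j u v x)"
    by (auto simp: even_term_def odd_term_def)
  with suminf_add[OF e o] suminf_diff[OF e o]
  have "biv_exp u v x = (\<Sum>j. even_term u v j x) + (\<Sum>j. odd_term u v j x)"
    "biv_exp (\<lambda>t. - u t) (\<lambda>t. - v t) x = (\<Sum>j. even_term u v j x) - (\<Sum>j. odd_term u v j x)"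
    by (simp_all add: biv_exp_eq_suminf)
  then show "biv_cosh u v x = (\<Sum>j. even_term u v j x)" "biv_sinh u v x = (\<Sum>j. odd_term u v j x)"
    by (simp_all add: biv_cosh_def biv_sinh_def)
qed

lemma continuous_on_biv_cosh: "continuous_on UNIV (biv_cosh u v)"
  unfolding biv_cosh_sinh_eq_suminf[abs_def]
  by (intro continuous_on_suminf_locally_M_bounded locally_M_bounded_terms continuous_on_terms)

lemma continuous_on_biv_sinh: "continuous_on UNIV (biv_sinh u v)"
  unfolding biv_cosh_sinh_eq_suminf[abs_def]
  by (intro continuous_on_suminf_locally_M_bounded locally_M_bounded_terms continuous_on_terms)

text \<open>A product of even length ends with the factor \<open>v\<close>, and stripping it leaves
  a product of odd length. The summand 1 is the term of index 0.\<close>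

lemma biv_cosh_eq_primitive: "biv_cosh u v x = 1 + primitive (\<lambda>t. v t * biv_sinh u v t) x"
proof -
  \<comment> \<open>For odd \<open>j\<close> this is the recursion; for even \<open>j\<close> both
    sides are zero.\<close>
  have "even_term u v (Suc j) x = primitive (\<lambda>t. v t * odd_term u v j t) x" for j
    by (cases "odd j") (simp_all add: even_term_def odd_term_def iter_int_Suc u v alt_factor_def
        primitive_def)
  then have "(\<lambda>j. even_term u v (Suc j) x) sums primitive (\<lambda>t. v t * biv_sinh u v t) x"
    using primitive_sums[OF v locally_M_bounded_terms(3) continuous_on_terms(2)]
    by (simp add: biv_cosh_sinh_eq_suminf)
  then have "(\<lambda>j. even_term u v j x) sums (primitive (\<lambda>t. v t * biv_sinh u v t) x + even_term u v 0 x)"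
    by (rule sums_Suc)
  moreover have "even_term u v 0 x = 1" by (simp add: even_term_def iter_int_def)
  ultimately show ?thesis
    by (simp add: biv_cosh_sinh_eq_suminf(1) add.commute sums_iff)
qed

lemma biv_sinh_eq_primitive: "biv_sinh u v x = primitive (\<lambda>t. u t * biv_cosh u v t) x"
proof -
  have "odd_term u v (Suc j) x = primitive (\<lambda>t. u t * even_term u v j t) x" for j
    by (cases "odd j") (simp_all add: even_term_def odd_term_def iter_int_Suc u v alt_factor_def
        primitive_def)
  then have "(\<lambda>j. odd_term u v (Suc j) x) sums primitive (\<lambda>t. u t * biv_cosh u v t) x"
    using primitive_sums[OF u locally_M_bounded_terms(2) continuous_on_terms(1)]
    by (simp add: biv_cosh_sinh_eq_suminf)
  then have "(\<lambda>j. odd_term u v j x) sums (primitive (\<lambda>t. u t * biv_cosh u v t) x + odd_term u v 0 x)"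
    by (rule sums_Suc)
  moreover have "odd_term u v 0 x = 0" by (simp add: odd_term_def)
  ultimately show ?thesis
    by (simp add: biv_cosh_sinh_eq_suminf(2) sums_iff)
qed

end

section \<open>The Schroedinger equation\<close>

text \<open>The equation has no first order term: in the derivative of the Wronskian the products
  \<open>z1 x * z2 x\<close> cancel, and so do the products
  \<open>Q x * y1 x * y2 x\<close>.\<close>

lemma wronskian_constant:
  assumes y1: "\<And>x. (y1 has_vector_derivative z1 x) (at x)" "locally_abs_continuous z1"
      "AE x in lebesgue. (z1 has_vector_derivative Q x * y1 x) (at x)"
    and y2: "\<And>x. (y2 has_vector_derivative z2 x) (at x)" "locally_abs_continuous z2"
      "AE x in lebesgue. (z2 has_vector_derivative Q x * y2 x) (at x)"
  shows "y1 x * z2 x - z1 x * y2 x = y1 0 * z2 0 - z1 0 * y2 0"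
proof (rule locally_abs_continuous_derivative_zero)
  have "locally_abs_continuous y1" "locally_abs_continuous y2"
    using C1_imp_locally_abs_continuous y1(1,2) y2(1,2) locally_abs_continuous_imp_continuous
    by blast+
  then show "locally_abs_continuous (\<lambda>x. y1 x * z2 x - z1 x * y2 x)"
    by (intro locally_abs_continuous_diff locally_abs_continuous_mult y1 y2)
  show "AE x in lebesgue. ((\<lambda>x. y1 x * z2 x - z1 x * y2 x) has_vector_derivative 0) (at x)"
    using y1(3) y2(3)
  proof eventually_elim
    case (elim x)
    have "((\<lambda>x. y1 x * z2 x - z1 x * y2 x) has_vector_derivative
        (y1 x * (Q x * y2 x) + z1 x * z2 x) - (z1 x * z2 x + Q x * y1 x * y2 x)) (at x)"
      by (intro has_vector_derivative_diff has_vector_derivative_mult y1(1) y2(1) elim)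
    then show ?case by (simp add: algebra_simps)
  qed
qed

text \<open>The equation as a first order system, with \<open>z\<close> naming the derivative of
  \<open>y\<close>. In this form candidates and given solutions can be fed to the Wronskian lemma
  alike.\<close>

lemma schroedinger_solution_iff:
  "schroedinger_solution q lam y \<longleftrightarrow>
     (\<exists>z. (\<forall>x. (y has_vector_derivative z x) (at x)) \<and> locally_abs_continuous z \<and>
       (AE x in lebesgue. (z has_vector_derivative (q x - lam) * y x) (at x)))"
    (is "_ \<longleftrightarrow> (\<exists>z. ?P z)")
proof
  assume "schroedinger_solution q lam y"
  then have y: "y C1_differentiable_on UNIV"
    "locally_abs_continuous (\<lambda>x. vector_derivative y (at x))"
    "AE x in lebesgue. \<exists>w. ((\<lambda>t. vector_derivative y (at t)) has_vector_derivative w) (at x) \<and>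
       - w + q x * y x = lam * y x"
    by (auto simp: schroedinger_solution_def)
  have "?P (\<lambda>x. vector_derivative y (at x))"
  proof (intro conjI allI)
    show "(y has_vector_derivative vector_derivative y (at x)) (at x)" for x
      using y(1) by (simp add: C1_differentiable_on_eq vector_derivative_works)
    show "AE x in lebesgue. ((\<lambda>x. vector_derivative y (at x)) has_vector_derivative
        (q x - lam) * y x) (at x)"
      using y(3)
    proof eventually_elim
      case (elim x)
      then obtain w where w: "((\<lambda>t. vector_derivative y (at t)) has_vector_derivative w) (at x)"
        "- w + q x * y x = lam * y x" by blast
      from w(2) have "w = (q x - lam) * y x" by (simp add: algebra_simps)
      with w(1) show ?case by simp
    qed
  qed (rule y(2))
  then show "\<exists>z. ?P z" by (rule exI[where P = ?P])
next
  assume "\<exists>z. ?P z"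
  then obtain z where z: "\<And>x. (y has_vector_derivative z x) (at x)" "locally_abs_continuous z"
    "AE x in lebesgue. (z has_vector_derivative (q x - lam) * y x) (at x)" by blast
  have [simp]: "vector_derivative y (at x) = z x" for x
    using z(1) by (rule vector_derivative_at)
  show "schroedinger_solution q lam y"
    unfolding schroedinger_solution_def C1_differentiable_on_def
  proof (intro conjI exI[of _ z] ballI)
    show "continuous_on UNIV z" by (rule locally_abs_continuous_imp_continuous[OF z(2)])
    show "AE x in lebesgue. \<exists>w. ((\<lambda>t. vector_derivative y (at t)) has_vector_derivative w) (at x) \<and>
       - w + q x * y x = lam * y x"
      using z(3) by eventually_elim (auto simp: algebra_simps)
  qed (simp_all add: z)
qed

text \<open>The constant 1 occupies the slot that differentiates \<open>c\<close> and
  \<open>s\<close>; their derivatives are therefore continuous and exist everywhere. The function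
  \<open>Q\<close> enters only through the derivatives of \<open>c'\<close> and \<open>s'\<close>,
  which are controlled almost everywhere.\<close>

lemma fundamental_system:
  assumes Q: "locally_integrable Q"
  defines "c \<equiv> biv_cosh Q (\<lambda>_. 1)" and "c' \<equiv> biv_sinh Q (\<lambda>_. 1)"
    and "s \<equiv> biv_sinh (\<lambda>_. 1) Q" and "s' \<equiv> biv_cosh (\<lambda>_. 1) Q"
  shows "(c has_vector_derivative c' x) (at x)" "locally_abs_continuous c'"
    "AE x in lebesgue. (c' has_vector_derivative Q x * c x) (at x)"
    "(s has_vector_derivative s' x) (at x)" "locally_abs_continuous s'"
    "AE x in lebesgue. (s' has_vector_derivative Q x * s x) (at x)"
    "c 0 = 1" "c' 0 = 0" "s 0 = 0" "s' 0 = 1"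
proof -
  have one: "locally_integrable (\<lambda>_. 1)" by (intro continuous_imp_locally_integrable continuous_intros)
  have c: "c = (\<lambda>x. 1 + primitive c' x)" "c' = primitive (\<lambda>t. Q t * c t)"
    unfolding c_def c'_def
    by (rule ext[OF biv_cosh_eq_primitive[OF Q one, unfolded mult_1]])
      (rule ext[OF biv_sinh_eq_primitive[OF Q one]])
  have s: "s = primitive s'" "s' = (\<lambda>x. 1 + primitive (\<lambda>t. Q t * s t) x)"
    unfolding s_def s'_def
    by (rule ext[OF biv_sinh_eq_primitive[OF one Q, unfolded mult_1]])
      (rule ext[OF biv_cosh_eq_primitive[OF one Q]])
  have cont: "continuous_on UNIV c" "continuous_on UNIV c'" "continuous_on UNIV s" "continuous_on UNIV s'"
    unfolding c_def c'_def s_def s'_def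
    by (intro continuous_on_biv_cosh continuous_on_biv_sinh Q one)+
  have int: "locally_integrable (\<lambda>t. Q t * c t)" "locally_integrable (\<lambda>t. Q t * s t)"
    using cont by (simp_all add: locally_integrable_mult_continuous Q)
  show "(c has_vector_derivative c' x) (at x)"
    by (subst c(1)) (auto intro!: derivative_eq_intros primitive_continuous_has_vector_derivative cont)
  show "(s has_vector_derivative s' x) (at x)"
    by (subst s(1)) (intro primitive_continuous_has_vector_derivative cont)
  show "locally_abs_continuous c'"
    by (subst c(2)) (intro locally_abs_continuous_primitive int)
  show "locally_abs_continuous s'"
    by (subst s(2)) (intro locally_abs_continuous_add locally_abs_continuous_const
        locally_abs_continuous_primitive int)
  show "AE x in lebesgue. (c' has_vector_derivative Q x * c x) (at x)"
    by (subst c(2)) (rule AE_primitive_has_vector_derivative[OF int(1)])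
  show "AE x in lebesgue. (s' has_vector_derivative Q x * s x) (at x)"
    using AE_primitive_has_vector_derivative[OF int(2)]
    by eventually_elim (subst s(2), auto intro!: derivative_eq_intros)
  show "c' 0 = 0" "s 0 = 0" by (simp_all add: c(2) s(1))
  show "c 0 = 1" by (subst c(1)) simp
  show "s' 0 = 1" by (subst s(2)) simp
qed

theorem mainTheorem7:
  fixes q :: "real \<Rightarrow> complex" and lam :: complex
  assumes "locally_integrable q"
  shows "(\<forall>a b. \<exists>y.
            y = (\<lambda>x. a * biv_cosh (\<lambda>t. q t - lam) (\<lambda>_. 1) x + b * biv_sinh (\<lambda>_. 1) (\<lambda>t. q t - lam) x) \<and>
            schroedinger_solution q lam y \<and> y 0 = a \<and> vector_derivative y (at 0) = b) \<and>
         (\<forall>y. schroedinger_solution q lam y \<longrightarrow>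
            y = (\<lambda>x. y 0 * biv_cosh (\<lambda>t. q t - lam) (\<lambda>_. 1) x
                   + vector_derivative y (at 0) * biv_sinh (\<lambda>_. 1) (\<lambda>t. q t - lam) x))"
proof -
  define Q where "Q = (\<lambda>t. q t - lam)"
  have Q: "locally_integrable Q"
    using assms unfolding Q_def locally_integrable_iff
    by (auto intro!: set_integral_diff absolutely_integrable_continuous_real continuous_intros)
  define c c' s s' where "c = biv_cosh Q (\<lambda>_. 1)" and "c' = biv_sinh Q (\<lambda>_. 1)"
    and "s = biv_sinh (\<lambda>_. 1) Q" and "s' = biv_cosh (\<lambda>_. 1) Q"
  note fs = fundamental_system[OF Q, folded c_def c'_def s_def s'_def]
  have ex: "schroedinger_solution q lam (\<lambda>x. a * c x + b * s x) \<and>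
      vector_derivative (\<lambda>x. a * c x + b * s x) (at 0) = b" for a b
  proof
    have d: "((\<lambda>x. a * c x + b * s x) has_vector_derivative a * c' x + b * s' x) (at x)" for x
      by (intro has_vector_derivative_add has_vector_derivative_mult_right fs)
    then show "vector_derivative (\<lambda>x. a * c x + b * s x) (at 0) = b"
      using vector_derivative_at[OF d[of 0]] by (simp add: fs)
    have "AE x in lebesgue. ((\<lambda>x. a * c' x + b * s' x) has_vector_derivative
        (q x - lam) * (a * c x + b * s x)) (at x)"
      using fs(3) fs(6)
    proof eventually_elim
      case (elim x)
      have "((\<lambda>x. a * c' x + b * s' x) has_vector_derivative
          a * (Q x * c x) + b * (Q x * s x)) (at x)"
        by (intro has_vector_derivative_add has_vector_derivative_mult_right elim)
      then show ?case by (simp add: Q_def algebra_simps)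
    qed
    moreover have "locally_abs_continuous (\<lambda>x. a * c' x + b * s' x)"
      by (intro locally_abs_continuous_add locally_abs_continuous_mult
          locally_abs_continuous_const fs)
    ultimately show "schroedinger_solution q lam (\<lambda>x. a * c x + b * s x)"
      unfolding schroedinger_solution_iff
      using d by (intro exI[of _ "\<lambda>x. a * c' x + b * s' x"] conjI allI)
  qed
  have un: "y x = y 0 * c x + vector_derivative y (at 0) * s x"
    if "schroedinger_solution q lam y" for y x
  proof -
    have "\<exists>z. (\<forall>x. (y has_vector_derivative z x) (at x)) \<and> locally_abs_continuous z \<and>
        (AE x in lebesgue. (z has_vector_derivative Q x * y x) (at x))"
      using that by (simp only: schroedinger_solution_iff Q_def)
    then obtain z where "\<forall>x. (y has_vector_derivative z x) (at x)" and z2: "locally_abs_continuous z"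
      "AE x in lebesgue. (z has_vector_derivative Q x * y x) (at x)"
      by (elim exE conjE)
    then have z: "(y has_vector_derivative z x) (at x)" for x by blast
    note z = z z2
    have "vector_derivative y (at 0) = z 0" using z(1) by (rule vector_derivative_at)
    moreover have "c x * s' x - c' x * s x = 1"
      using wronskian_constant[OF fs(1,2,3) fs(4,5,6), of x] by (simp add: fs)
    moreover have "y x * s' x - z x * s x = y 0"
      using wronskian_constant[OF z fs(4,5,6), of x] by (simp add: fs)
    moreover have "c x * z x - c' x * y x = z 0"
      using wronskian_constant[OF fs(1,2,3) z, of x] by (simp add: fs)
    \<comment> \<open>Cramer's rule: this identity is purely algebraic, and the three Wronskians in
      it are the constants \<open>1\<close>, \<open>y 0\<close> and \<open>z 0\<close>, found by
      evaluating at 0.\<close>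
    moreover have "y x * (c x * s' x - c' x * s x)
        = (y x * s' x - z x * s x) * c x + (c x * z x - c' x * y x) * s x"
      by (simp add: algebra_simps)
    ultimately show ?thesis by simp
  qed
  show ?thesis
    unfolding Q_def[symmetric] c_def[symmetric] s_def[symmetric]
    using ex un by (auto simp: fs)
qed

end
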